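(* For $(\alpha,\beta,\gamma,\delta)\in\mathbb{C}^4\simeq\mathbb{R}^8$ let $$M(\alpha,\beta,\gamma,\delta)=\begin{pmatrix} 0&\bar\alpha&0&0&\bar\gamma&0&\bar\delta\\ \alpha&0&\beta&\gamma&0&\delta&0\\ 0&\bar\beta&0&0&0&0&0\\ 0&\bar\gamma&0&0&0&0&0\\ \gamma&0&0&0&0&0&0\\ 0&\bar\delta&0&0&0&0&0\\ \delta&0&0&0&0&0&0 \end{pmatrix},$$ and let $H\colon\mathbb{C}^7\times\mathbb{C}^7\to\mathbb{C}^8$ be the vector valued hermitian form whose eight components are the scalar hermitian forms on $\mathbb{C}^7$ with matrices $M(e_1),\dots,M(e_8)$, where $e_1,\dots,e_8$ is the standard real basis of $\mathbb{C}^4\simeq\mathbb{R}^8$. Let $\mathfrak{g}=\bigoplus_{i=-2}^{2}\mathfrak{g}_i$ be the Levi-Tanaka algebra associated to $H$. Then $$\dim_{\mathbb{R}}\mathfrak{g}_1\ge 16>14=\dim_{\mathbb{R}}\mathfrak{g}_{-1}\quad\text{and}\quad \dim_{\mathbb{R}}\mathfrak{g}_2\ge10>8=\dim_{\mathbb{R}}\mathfrak{g}_{-2}.$$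
   Context: The Levi-Tanaka algebra associated to a vector valued hermitian form $H\colon\mathbb{C}^n\times\mathbb{C}^n\to\mathbb{C}^k$ (linear in the first and anti-linear in the second variable, $H(z,z)\in\mathbb{R}^k$) which is nondegenerate (for every $z\ne0$ there is $z'$ with $H(z,z')\neq0$) and fundamental ($\{H(z,z)\}$ spans $\mathbb{R}^k$) is defined as follows. Let $\mathfrak{m}_{-1}=\mathbb{C}^n$ with complex structure $J$ (multiplication by $\mathrm{i}$), $\mathfrak{m}_{-2}=\mathbb{R}^k$, and let $\mathfrak{m}_-=\mathfrak{m}_{-1}\oplus\mathfrak{m}_{-2}$ be the real graded Lie algebra with $[X,Y]=\mathrm{Im}\,H(X,Y)$ for $X,Y\in\mathfrak{m}_{-1}$ and all other brackets zero. Let $\mathfrak{m}_0$ be the algebra of degree-$0$ derivations of $\mathfrak{m}_-$ whose restriction to $\mathfrak{m}_{-1}$ commutes with $J$. The Levi-Tanaka algebra is the unique graded real Lie algebra $\mathfrak{g}=\bigoplus_{p\in\mathbb{Z}}\mathfrak{g}_p$ such that $\mathfrak{g}_p=\mathfrak{m}_p$ for $p\le0$; $\mathrm{ad}(X)|_{\mathfrak{g}_{-1}}\ne0$ for all $0\neq X\in\mathfrak{g}_p$, $p\ge0$; and $\mathfrak{g}$ is maximal with these properties. It is finite dimensional with $\mathfrak{g}_p=0$ for $|p|>2$, and it is canonically isomorphic to the Lie algebra of infinitesimal CR automorphisms of the affine quadric $\{(z,w)\in\mathbb{C}^n\oplus\mathbb{C}^k\mid\mathrm{Im}\,w=H(z,z)\}$.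 A hermitian matrix $M$ defines the scalar hermitian form $(z,z')\mapsto \overline{z'}^{\,T}Mz$. *)

theory Defs
  imports "HOL-Analysis.Analysis" "HOL-Analysis.Finite_Function_Topology"
begin

section \<open>Graded real Lie algebras\<close>

text \<open>
  The Lie algebra lives on a linear subspace \<open>L\<close> of a real vector space. The bracket is a function
  on the whole ambient space, of which only the restriction to \<open>L\<close> matters; requiring global
  bilinearity is no restriction, since a bilinear map on a subspace always extends.
\<close>

locale real_lie_algebra =
  fixes L :: "'a::real_vector set" and br :: "'a \<Rightarrow> 'a \<Rightarrow> 'a"
  assumes subspace: "subspace L"
    and bilinear: "bilinear br"
    and closed: "\<lbrakk>x \<in> L; y \<in> L\<rbrakk> \<Longrightarrow> br x y \<in> L"
    and alternating: "x \<in> L \<Longrightarrow> br x x = 0"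
    and Jacobi: "\<lbrakk>x \<in> L; y \<in> L; z \<in> L\<rbrakk> \<Longrightarrow>
      br x (br y z) + br y (br z x) + br z (br x y) = 0"

definition total_space :: "(int \<Rightarrow> 'a::real_vector set) \<Rightarrow> 'a set" where
  "total_space G = span (\<Union>p. G p)"

locale graded_lie_algebra =
  fixes G :: "int \<Rightarrow> 'a::real_vector set" and br :: "'a \<Rightarrow> 'a \<Rightarrow> 'a"
  assumes lie_algebra: "real_lie_algebra (total_space G) br"
    and component: "subspace (G p)"
    and direct_sum: "\<lbrakk>finite S; \<And>p. p \<in> S \<Longrightarrow> x p \<in> G p; (\<Sum>p\<in>S. x p) = 0; q \<in> S\<rbrakk> \<Longrightarrow> x q = 0"
    and graded: "\<lbrakk>x' \<in> G p; y' \<in> G q\<rbrakk> \<Longrightarrow> br x' y' \<in> G (p + q)"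

text \<open>Linear maps between subspaces extend to the ambient spaces, so \<open>f\<close> may be taken linear everywhere.\<close>

definition graded_lie_embedding ::
  "(int \<Rightarrow> 'a::real_vector set) \<Rightarrow> ('a \<Rightarrow> 'a \<Rightarrow> 'a) \<Rightarrow>
   (int \<Rightarrow> 'b::real_vector set) \<Rightarrow> ('b \<Rightarrow> 'b \<Rightarrow> 'b) \<Rightarrow> ('a \<Rightarrow> 'b) \<Rightarrow> bool" where
  "graded_lie_embedding G br G' br' f \<longleftrightarrow>
     linear f \<and> inj_on f (total_space G) \<and> (\<forall>p. f ` G p \<subseteq> G' p) \<and>
     (\<forall>x\<in>total_space G. \<forall>y\<in>total_space G. f (br x y) = br' (f x) (f y))"


section \<open>Vector valued hermitian forms\<close>

definition hermitian_form :: "(complex^'n \<Rightarrow> complex^'n \<Rightarrow> complex^'k) \<Rightarrow> bool" where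
  "hermitian_form H \<longleftrightarrow>
     (\<forall>x y z. H (x + y) z = H x z + H y z) \<and> (\<forall>c x z. H (c *s x) z = c *s H x z) \<and>
     (\<forall>x y z. H z (x + y) = H z x + H z y) \<and> (\<forall>c x z. H z (c *s x) = cnj c *s H z x) \<and>
     (\<forall>z i. H z z $ i \<in> \<real>)"

definition nondegenerate :: "(complex^'n \<Rightarrow> complex^'n \<Rightarrow> complex^'k) \<Rightarrow> bool" where
  "nondegenerate H \<longleftrightarrow> (\<forall>z. z \<noteq> 0 \<longrightarrow> (\<exists>z'. H z z' \<noteq> 0))"

definition Re_vec :: "complex^'k \<Rightarrow> real^'k" where
  "Re_vec w = (\<chi> i. Re (w $ i))"

definition Im_vec :: "complex^'k \<Rightarrow> real^'k" where
  "Im_vec w = (\<chi> i. Im (w $ i))"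

text \<open>For a hermitian form, \<open>H z z\<close> is a real vector, identified with \<open>Re_vec (H z z)\<close>.\<close>

definition fundamental :: "(complex^'n \<Rightarrow> complex^'n \<Rightarrow> complex^'k) \<Rightarrow> bool" where
  "fundamental H \<longleftrightarrow> span (range (\<lambda>z. Re_vec (H z z))) = UNIV"


section \<open>The algebras \<open>\<mm>\<^sub>-\<close> and \<open>\<mm>\<^sub>0\<close>\<close>

type_synonym ('n, 'k) neg = "(complex^'n) \<times> (real^'k)"

definition m_deg :: "int \<Rightarrow> ('n::finite, 'k::finite) neg set" where
  "m_deg p = (if p = -1 then {(z, 0) | z. True} else if p = -2 then {(0, t) | t. True} else {0})"

definition m_bracket :: "(complex^'n \<Rightarrow> complex^'n \<Rightarrow> complex^'k) \<Rightarrow>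
    ('n::finite, 'k::finite) neg \<Rightarrow> ('n, 'k) neg \<Rightarrow> ('n, 'k) neg" where
  "m_bracket H x y = (0, Im_vec (H (fst x) (fst y)))"

text \<open>Since everything is finite dimensional, \<open>\<Rightarrow>\<^sub>L\<close> is the space of all real linear maps.\<close>

definition m_zero :: "(complex^'n \<Rightarrow> complex^'n \<Rightarrow> complex^'k) \<Rightarrow>
    (('n::finite, 'k::finite) neg \<Rightarrow>\<^sub>L ('n, 'k) neg) set" where
  "m_zero H = {D :: ('n, 'k) neg \<Rightarrow>\<^sub>L ('n, 'k) neg.
     (\<forall>x y. D (m_bracket H x y) = m_bracket H (D x) y + m_bracket H x (D y)) \<and>
     (\<forall>p. D ` m_deg p \<subseteq> m_deg p) \<and>
     (\<forall>z. fst (D (\<i> *s z, 0)) = \<i> *s fst (D (z, 0)))}"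

text \<open>
  The graded Lie algebra \<open>\<mm>\<^sub>-\<^sub>2 \<oplus> \<mm>\<^sub>-\<^sub>1 \<oplus> \<mm>\<^sub>0\<close>: the semidirect product of \<open>\<mm>\<^sub>-\<close> with its
  algebra \<open>\<mm>\<^sub>0\<close> of derivations.
\<close>

type_synonym ('n, 'k) nonpos = "('n, 'k) neg \<times> (('n, 'k) neg \<Rightarrow>\<^sub>L ('n, 'k) neg)"

definition nonpos_deg :: "(complex^'n \<Rightarrow> complex^'n \<Rightarrow> complex^'k) \<Rightarrow> int \<Rightarrow>
    ('n::finite, 'k::finite) nonpos set" where
  "nonpos_deg H p = (if p = 0 then {0} \<times> m_zero H else m_deg p \<times> {0})"

definition nonpos_bracket :: "(complex^'n \<Rightarrow> complex^'n \<Rightarrow> complex^'k) \<Rightarrow>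
    ('n::finite, 'k::finite) nonpos \<Rightarrow> ('n, 'k) nonpos \<Rightarrow> ('n, 'k) nonpos" where
  "nonpos_bracket H = (\<lambda>(x, D) (y, E).
     (m_bracket H x y + blinfun_apply D y - blinfun_apply E x, (D o\<^sub>L E) - (E o\<^sub>L D)))"


section \<open>Levi-Tanaka algebras\<close>

text \<open>
  The equality of \<open>\<gg>\<^sub>p\<close> and \<open>\<mm>\<^sub>p\<close> for \<open>p \<le> 0\<close> is witnessed by an embedding \<open>\<iota>\<close> of the graded Lie
  algebra of non-positive degree.
\<close>

definition transitive_prolongation :: "(complex^'n \<Rightarrow> complex^'n \<Rightarrow> complex^'k) \<Rightarrow>
    (int \<Rightarrow> 'a::real_vector set) \<Rightarrow> ('a \<Rightarrow> 'a \<Rightarrow> 'a) \<Rightarrow>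
    (('n::finite, 'k::finite) nonpos \<Rightarrow> 'a) \<Rightarrow> bool" where
  "transitive_prolongation H G br \<iota> \<longleftrightarrow>
     graded_lie_algebra G br \<and>
     graded_lie_embedding (nonpos_deg H) (nonpos_bracket H) G br \<iota> \<and>
     (\<forall>p\<le>0. \<iota> ` nonpos_deg H p = G p) \<and>
     (\<forall>p\<ge>0. \<forall>x\<in>G p. x \<noteq> 0 \<longrightarrow> (\<exists>y\<in>G (-1). br x y \<noteq> 0))"

text \<open>
  Maximality: every embedding into another transitive prolongation, inducing the identity on the
  non-positive part (that is, the identification for \<open>G'\<close> is \<open>f \<circ> \<iota>\<close>), is onto. By transitivity the
  components of a transitive prolongation are finite dimensional, so every transitive prolongation
  has an isomorphic copy in the space \<open>(nat, real) poly_mapping\<close> of countable dimension, and quantifying over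
  those whose elements lie in that space amounts to quantifying over all of them.
\<close>

definition levi_tanaka_algebra :: "(complex^'n \<Rightarrow> complex^'n \<Rightarrow> complex^'k) \<Rightarrow>
    (int \<Rightarrow> 'a::real_vector set) \<Rightarrow> ('a \<Rightarrow> 'a \<Rightarrow> 'a) \<Rightarrow>
    (('n::finite, 'k::finite) nonpos \<Rightarrow> 'a) \<Rightarrow> bool" where
  "levi_tanaka_algebra H G br \<iota> \<longleftrightarrow>
     hermitian_form H \<and> nondegenerate H \<and> fundamental H \<and>
     transitive_prolongation H G br \<iota> \<and>
     (\<forall>(G' :: int \<Rightarrow> (nat, real) poly_mapping set) br' f.
        transitive_prolongation H G' br' (f \<circ> \<iota>) \<and> graded_lie_embedding G br G' br' f
        \<longrightarrow> (\<forall>p. f ` G p = G' p))"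


section \<open>The example\<close>

definition M_mat :: "complex \<Rightarrow> complex \<Rightarrow> complex \<Rightarrow> complex \<Rightarrow> complex^7^7" where
  "M_mat \<alpha> \<beta> \<gamma> \<delta> = vector [
     vector [0,     cnj \<alpha>, 0, 0, cnj \<gamma>, 0, cnj \<delta>],
     vector [\<alpha>,     0,     \<beta>, \<gamma>, 0,     \<delta>, 0    ],
     vector [0,     cnj \<beta>, 0, 0, 0,     0, 0    ],
     vector [0,     cnj \<gamma>, 0, 0, 0,     0, 0    ],
     vector [\<gamma>,     0,     0, 0, 0,     0, 0    ],
     vector [0,     cnj \<delta>, 0, 0, 0,     0, 0    ],
     vector [\<delta>,     0,     0, 0, 0,     0, 0    ]]"

definition scalar_form :: "complex^'n^'n \<Rightarrow> complex^'n \<Rightarrow> complex^'n \<Rightarrow> complex" where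
  "scalar_form A z z' = (\<Sum>i\<in>UNIV. cnj (z' $ i) * (A *v z) $ i)"

text \<open>
  The real basis of \<open>\<complex>\<^sup>4\<close> is ordered according to the real coordinates
  \<open>(Re \<alpha>, Im \<alpha>, Re \<beta>, Im \<beta>, Re \<gamma>, Im \<gamma>, Re \<delta>, Im \<delta>)\<close>.
\<close>

definition M_basis :: "complex^7^7^8" where
  "M_basis = vector [M_mat 1 0 0 0, M_mat \<i> 0 0 0, M_mat 0 1 0 0, M_mat 0 \<i> 0 0,
                     M_mat 0 0 1 0, M_mat 0 0 \<i> 0, M_mat 0 0 0 1, M_mat 0 0 0 \<i>]"

definition H_M :: "complex^7 \<Rightarrow> complex^7 \<Rightarrow> complex^8" where
  "H_M z z' = (\<chi> j. scalar_form (M_basis $ j) z z')"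


lemma exhaust_7:
  fixes x :: 7
  shows "x = 1 \<or> x = 2 \<or> x = 3 \<or> x = 4 \<or> x = 5 \<or> x = 6 \<or> x = 7"
proof (induct x)
  case (of_int z)
  then have "0 \<le> z" and "z < 7" by simp_all
  then have "z = 0 \<or> z = 1 \<or> z = 2 \<or> z = 3 \<or> z = 4 \<or> z = 5 \<or> z = 6" by arith
  then show ?case by auto
qed

lemma UNIV_7: "(UNIV :: 7 set) = {1, 2, 3, 4, 5, 6, 7}"
  using exhaust_7 by auto

lemma exhaust_8:
  fixes x :: 8
  shows "x = 1 \<or> x = 2 \<or> x = 3 \<or> x = 4 \<or> x = 5 \<or> x = 6 \<or> x = 7 \<or> x = 8"
proof (induct x)
  case (of_int z)
  then have "0 \<le> z" and "z < 8" by simp_all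
  then have "z = 0 \<or> z = 1 \<or> z = 2 \<or> z = 3 \<or> z = 4 \<or> z = 5 \<or> z = 6 \<or> z = 7" by arith
  then show ?case by auto
qed

lemma UNIV_8: "(UNIV :: 8 set) = {1, 2, 3, 4, 5, 6, 7, 8}"
  using exhaust_8 by auto

lemma vector_7:
  fixes a1 :: "'a::zero"
  shows
    "(vector [a1, a2, a3, a4, a5, a6, a7] :: 'a^7) $ 1 = a1"
    "(vector [a1, a2, a3, a4, a5, a6, a7] :: 'a^7) $ 2 = a2"
    "(vector [a1, a2, a3, a4, a5, a6, a7] :: 'a^7) $ 3 = a3"
    "(vector [a1, a2, a3, a4, a5, a6, a7] :: 'a^7) $ 4 = a4"
    "(vector [a1, a2, a3, a4, a5, a6, a7] :: 'a^7) $ 5 = a5"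
    "(vector [a1, a2, a3, a4, a5, a6, a7] :: 'a^7) $ 6 = a6"
    "(vector [a1, a2, a3, a4, a5, a6, a7] :: 'a^7) $ 7 = a7"
  by (simp_all add: vector_def)

lemma vector_8:
  fixes a1 :: "'a::zero"
  shows
    "(vector [a1, a2, a3, a4, a5, a6, a7, a8] :: 'a^8) $ 1 = a1"
    "(vector [a1, a2, a3, a4, a5, a6, a7, a8] :: 'a^8) $ 2 = a2"
    "(vector [a1, a2, a3, a4, a5, a6, a7, a8] :: 'a^8) $ 3 = a3"
    "(vector [a1, a2, a3, a4, a5, a6, a7, a8] :: 'a^8) $ 4 = a4"
    "(vector [a1, a2, a3, a4, a5, a6, a7, a8] :: 'a^8) $ 5 = a5"
    "(vector [a1, a2, a3, a4, a5, a6, a7, a8] :: 'a^8) $ 6 = a6"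
    "(vector [a1, a2, a3, a4, a5, a6, a7, a8] :: 'a^8) $ 7 = a7"
    "(vector [a1, a2, a3, a4, a5, a6, a7, a8] :: 'a^8) $ 8 = a8"
  by (simp_all add: vector_def)

lemma sum_7: "sum f (UNIV :: 7 set) = f 1 + f 2 + f 3 + f 4 + f 5 + f 6 + f 7"
  unfolding UNIV_7 by (simp add: ac_simps)

lemma scalar_form_M_mat:
  "scalar_form (M_mat \<alpha> \<beta> \<gamma> \<delta>) z z' =
     \<alpha> * (z$1 * cnj (z'$2)) + cnj \<alpha> * (z$2 * cnj (z'$1)) +
     \<beta> * (z$3 * cnj (z'$2)) + cnj \<beta> * (z$2 * cnj (z'$3)) +
     \<gamma> * (z$4 * cnj (z'$2) + z$1 * cnj (z'$5)) +
     cnj \<gamma> * (z$2 * cnj (z'$4) + z$5 * cnj (z'$1)) +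
     \<delta> * (z$6 * cnj (z'$2) + z$1 * cnj (z'$7)) +
     cnj \<delta> * (z$2 * cnj (z'$6) + z$7 * cnj (z'$1))"
  unfolding scalar_form_def M_mat_def matrix_vector_mult_def sum_7 vec_lambda_beta vector_7 by algebra

lemma H_M_component:
  "H_M z z' $ 1 = z$1 * cnj (z'$2) + z$2 * cnj (z'$1)"
  "H_M z z' $ 2 = \<i> * (z$1 * cnj (z'$2) - z$2 * cnj (z'$1))"
  "H_M z z' $ 3 = z$3 * cnj (z'$2) + z$2 * cnj (z'$3)"
  "H_M z z' $ 4 = \<i> * (z$3 * cnj (z'$2) - z$2 * cnj (z'$3))"
  "H_M z z' $ 5 = z$4 * cnj (z'$2) + z$1 * cnj (z'$5) + z$2 * cnj (z'$4) + z$5 * cnj (z'$1)"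
  "H_M z z' $ 6 = \<i> * (z$4 * cnj (z'$2) + z$1 * cnj (z'$5) - z$2 * cnj (z'$4) - z$5 * cnj (z'$1))"
  "H_M z z' $ 7 = z$6 * cnj (z'$2) + z$1 * cnj (z'$7) + z$2 * cnj (z'$6) + z$7 * cnj (z'$1)"
  "H_M z z' $ 8 = \<i> * (z$6 * cnj (z'$2) + z$1 * cnj (z'$7) - z$2 * cnj (z'$6) - z$7 * cnj (z'$1))"
  by (simp_all add: H_M_def M_basis_def vector_8 scalar_form_M_mat algebra_simps)

lemma forall_8: "(\<forall>i::8. P i) \<longleftrightarrow> P 1 \<and> P 2 \<and> P 3 \<and> P 4 \<and> P 5 \<and> P 6 \<and> P 7 \<and> P 8"
  using exhaust_8 by metis

lemma hermitian_form_H_M: "hermitian_form H_M"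
proof -
  have "H_M (x + y) z = H_M x z + H_M y z" for x y z
    by (simp add: vec_eq_iff forall_8 H_M_component algebra_simps)
  moreover have "H_M (c *s x) z = c *s H_M x z" for c x z
    by (simp add: vec_eq_iff forall_8 H_M_component algebra_simps)
  moreover have "H_M z (x + y) = H_M z x + H_M z y" for x y z
    by (simp add: vec_eq_iff forall_8 H_M_component algebra_simps)
  moreover have "H_M z (c *s x) = cnj c *s H_M z x" for c x z
    by (simp add: vec_eq_iff forall_8 H_M_component algebra_simps)
  moreover have "\<forall>i. H_M z z $ i \<in> \<real>" for z
    by (simp add: forall_8 H_M_component complex_is_Real_iff)
  ultimately show ?thesis
    unfolding hermitian_form_def by blast
qed

lemma nondegenerate_H_M: "nondegenerate H_M"
  unfolding nondegenerate_def
proof (intro allI impI, rule ccontr)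
  fix z :: "complex^7"
  assume "z \<noteq> 0" and "\<nexists>z'. H_M z z' \<noteq> 0"
  then have h: "H_M z (axis i 1) $ j = 0" for i j by simp
  have "z $ i = 0" for i
  proof -
    have "i \<in> {1, 2, 3, 4, 5, 6, 7}" using exhaust_7[of i] by blast
    then show ?thesis
      using h[of 1 1] h[of 2 1] h[of 2 3] h[of 2 5] h[of 1 5] h[of 2 7] h[of 1 7]
      by (auto simp: H_M_component axis_def)
  qed
  with \<open>z \<noteq> 0\<close> show False by (simp add: vec_eq_iff)
qed

lemma H_M_axis:
  shows
    "axis 1 2 = Re_vec (H_M (axis 2 1 + axis 1 1) (axis 2 1 + axis 1 1))"
    "axis 2 2 = Re_vec (H_M (axis 2 1 + axis 1 (-\<i>)) (axis 2 1 + axis 1 (-\<i>)))"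
    "axis 3 2 = Re_vec (H_M (axis 2 1 + axis 3 1) (axis 2 1 + axis 3 1))"
    "axis 4 2 = Re_vec (H_M (axis 2 1 + axis 3 (-\<i>)) (axis 2 1 + axis 3 (-\<i>)))"
    "axis 5 2 = Re_vec (H_M (axis 2 1 + axis 4 1) (axis 2 1 + axis 4 1))"
    "axis 6 2 = Re_vec (H_M (axis 2 1 + axis 4 (-\<i>)) (axis 2 1 + axis 4 (-\<i>)))"
    "axis 7 2 = Re_vec (H_M (axis 2 1 + axis 6 1) (axis 2 1 + axis 6 1))"
    "axis 8 2 = Re_vec (H_M (axis 2 1 + axis 6 (-\<i>)) (axis 2 1 + axis 6 (-\<i>)))"
  by (simp_all add: vec_eq_iff forall_8 Re_vec_def H_M_component axis_def)

lemma fundamental_H_M: "fundamental H_M"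
proof -
  let ?S = "span (range (\<lambda>z. Re_vec (H_M z z)))"
  have "axis j (1::real) \<in> ?S" for j :: 8
  proof -
    have "\<exists>z. axis j 2 = Re_vec (H_M z z)"
      using exhaust_8[of j] by (elim disjE) (hypsubst, intro exI, rule H_M_axis)+
    then have "axis j 2 \<in> range (\<lambda>z. Re_vec (H_M z z))"
      by (simp add: image_iff)
    then have "(1/2) *\<^sub>R axis j 2 \<in> ?S"
      by (intro span_scale span_base)
    moreover have "(1/2) *\<^sub>R axis j 2 = axis j (1::real)"
      by (simp add: vec_eq_iff axis_def)
    ultimately show ?thesis
      by (simp only:)
  qed
  then have "(Basis :: (real^8) set) \<subseteq> ?S"
    by (auto simp: Basis_vec_def)
  then have "span Basis \<subseteq> ?S"
    by (rule span_minimal[OF _ subspace_span])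
  then show ?thesis
    unfolding fundamental_def span_Basis by (rule top.extremum_uniqueI)
qed

end

theory Submission
  imports Defs "HOL-Library.Function_Algebras"
begin

text \<open>
  By maximality, the Levi-Tanaka algebra \<open>\<gg>\<close> fills up every transitive prolongation into which it
  embeds compatibly with the identifications in non-positive degree. So it suffices to construct one
  universal transitive prolongation, to embed \<open>\<gg>\<close> into it, and to find enough elements of degrees 1
  and 2 there.

  \<^bold>\<open>The universal prolongation.\<close> Let \<open>\<pi>\<close> be the projection of \<open>\<gg>\<close> onto \<open>\<mm>\<^sub>-\<close> that kills the
  non-negative part. By transitivity an element \<open>x\<close> is determined by its jet, the function
  \<open>[y1, ..., yn] \<mapsto> \<pi> ([...[x, y1], ..., yn])\<close> on words in \<open>\<mm>\<^sub>-\<close>. Since \<open>ad y\<close> is a derivation and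
  \<open>\<pi>\<close> vanishes on brackets of non-negative elements, the jet of \<open>[x, x']\<close> is computed from the jets of
  \<open>x\<close> and \<open>x'\<close> alone (\<open>jet_bracket\<close>). This formula makes sense for any two jets that are multilinear
  and factor through the universal enveloping algebra of \<open>\<mm>\<^sub>-\<close> (\<open>coinduced\<close>), and on these it
  satisfies the Jacobi identity (\<open>jet_bracket_Jacobi\<close>): they are the formal vector fields on the
  group of \<open>\<mm>\<^sub>-\<close>, expanded in a left invariant frame. Inside this Lie algebra the universal
  prolongation \<open>tanaka\<close> starts with the jets of \<open>\<mm>\<^sub>-\<close> and \<open>\<mm>\<^sub>0\<close>, and continues in positive degree with
  all jets whose brackets with \<open>\<mm>\<^sub>-\<close> lie in the components already constructed. It is a graded
  transitive Lie algebra with finite dimensional components, and \<open>x \<mapsto> jet x\<close> embeds \<open>\<gg>\<close> into it.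
  Hence \<open>dim \<gg>\<^sub>p = dim (tanaka H p)\<close> for all \<open>p\<close> (\<open>levi_tanaka_dim\<close>).

  \<^bold>\<open>The example.\<close> Let \<open>A = \<complex>[e0, e1, e2] / (ei ej)\<close>, and let \<open>R \<subseteq> A\<close> be the subring spanned by
  \<open>1, e1, e2\<close>. Put \<open>x = z1 + z3 e0 + z4 e1 + z6 e2 \<in> A\<close>, \<open>y = cnj z2 + cnj z5 e1 + cnj z7 e2 \<in> R\<close>
  and identify \<open>\<real>\<^sup>8\<close> with \<open>A\<close>. Then the bracket of \<open>\<mm>\<^sub>-\<close> is \<open>x y' - x' y\<close>, and \<open>J\<close> is
  multiplication by \<open>\<i>\<close> on \<open>x\<close> and by \<open>-\<i>\<close> on \<open>y\<close>. With \<open>R\<close> in place of \<open>A\<close> this would be the negative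
  part of \<open>\<ss>\<ll>\<^sub>3(R)\<close>; its positive part, adapted to \<open>A\<close>, consists of the following. An \<open>R\<close>-linear
  map \<open>\<phi> : A \<rightarrow> R\<close> gives an element of degree 2, namely the quadratic vector field
  \<open>\<phi>(x) u \<partial>\<^sub>x + \<phi>(u) u \<partial>\<^sub>u\<close>, which permutes the graphs \<open>u = v + x y\<close> with \<open>v \<in> A\<close>, \<open>y \<in> R\<close>. A pair
  of \<open>c \<in> R\<close> and such a \<open>\<phi>\<close> gives an element of degree 1. The maps \<open>\<phi>\<close> are the multiplications of
  the \<open>R\<close>-component by elements of \<open>R\<close> together with the maps that send \<open>e0\<close> into the span of
  \<open>e1, e2\<close>; the latter are what makes the degrees 1 and 2 larger than the
  degrees -1 and -2. They form a space of complex dimension \<open>3 + 2 = 5\<close>, so there are at least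
  \<open>2 (3 + 5) = 16\<close> real dimensions in degree 1 and \<open>2 \<sqdot> 5 = 10\<close> in degree 2.
\<close>

section \<open>Linear algebra in spaces of functions\<close>

instantiation "fun" :: (type, real_vector) real_vector
begin

definition scaleR_fun_def: "r *\<^sub>R f = (\<lambda>x. r *\<^sub>R f x)"

instance
  by standard (simp_all add: scaleR_fun_def fun_eq_iff scaleR_add_right scaleR_add_left)

end

lemma scaleR_fun_apply [simp]: "(r *\<^sub>R f) x = r *\<^sub>R f x" for f :: "'b \<Rightarrow> 'c::real_vector"
  by (simp add: scaleR_fun_def)

lemma sum_fun_apply: "sum f S x = (\<Sum>i\<in>S. f i x)"
  for f :: "'i \<Rightarrow> 'b \<Rightarrow> 'c::comm_monoid_add"
  by (induction S rule: infinite_finite_induct) simp_all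

lemma linear_fun_iff: "linear f \<longleftrightarrow> (\<forall>w. linear (\<lambda>x. f x w))"
  for f :: "'a::real_vector \<Rightarrow> 'b \<Rightarrow> 'c::real_vector"
  by (auto simp: linear_iff fun_eq_iff)

lemma linear_apply [intro, simp]: "linear (\<lambda>f :: 'b \<Rightarrow> 'c::real_vector. f x)"
  by (simp add: linear_iff)

definition findim :: "'a::real_vector set \<Rightarrow> bool" where
  "findim V \<longleftrightarrow> (\<exists>F. finite F \<and> V \<subseteq> span F)"

lemma findim_linear_image:
  assumes "findim V" "linear f"
  shows "findim (f ` V)"
proof -
  obtain F where "finite F" "V \<subseteq> span F" using assms(1) by (auto simp: findim_def)
  then have "f ` V \<subseteq> span (f ` F)" using linear_span_image[OF assms(2)] by blast
  then show ?thesis using \<open>finite F\<close> unfolding findim_def by blast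
qed

lemma findim_subset: "findim V \<Longrightarrow> W \<subseteq> V \<Longrightarrow> findim W"
  by (auto simp: findim_def)

lemma findim_basis:
  assumes "findim V"
  obtains F where "finite F" "F \<subseteq> V" "V \<subseteq> span F"
proof -
  obtain F where F: "finite F" "V \<subseteq> span F" using assms by (auto simp: findim_def)
  obtain B where "B \<subseteq> V" "independent B" "V \<subseteq> span B" by (rule maximal_independent_subset)
  then show ?thesis using that independent_span_bound[OF F(1), of B] F(2) by blast
qed

lemma findim_euclidean: "findim (V :: 'a::euclidean_space set)"
  unfolding findim_def using finite_Basis span_Basis by blast

text \<open>
  Elements of positive degree are known by their brackets with a basis of \<open>\<mm>\<^sub>-\<^sub>1\<close>, so this passes finite
  dimensionality from one degree to the next. For one more map \<open>L i\<close>, lift a basis of its image: what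
  remains is its kernel, to which the induction hypothesis applies.
\<close>

lemma findim_joint_kernel:
  assumes "finite I" "subspace V" "\<And>i. i \<in> I \<Longrightarrow> linear (L i)" "\<And>i. i \<in> I \<Longrightarrow> findim (L i ` V)"
    and "\<And>v. v \<in> V \<Longrightarrow> (\<And>i. i \<in> I \<Longrightarrow> L i v = 0) \<Longrightarrow> v = 0"
  shows "findim V"
  using assms
proof (induction I arbitrary: V rule: finite_induct)
  case empty
  then have "V \<subseteq> span {}" by auto
  then show ?case unfolding findim_def by blast
next
  case (insert i I)
  define K where "K = {v \<in> V. L i v = 0}"
  have li: "linear (L i)" using insert.prems by simp
  have K: "subspace K"
    unfolding K_def using subspace_inter[OF insert.prems(1) linear_subspace_kernel[OF li]]
    by (simp add: Collect_conj_eq)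
  have "findim K"
  proof (rule insert.IH[OF K])
    show "linear (L j)" if "j \<in> I" for j using insert.prems that by simp
    show "findim (L j ` K)" if "j \<in> I" for j
      by (rule findim_subset[of "L j ` V"]) (use insert.prems(3) that in \<open>auto simp: K_def\<close>)
    show "v = 0" if "v \<in> K" "\<And>j. j \<in> I \<Longrightarrow> L j v = 0" for v
      by (rule insert.prems(4)) (use that in \<open>auto simp: K_def\<close>)
  qed
  then obtain F where F: "finite F" "K \<subseteq> span F" by (auto simp: findim_def)
  obtain E where E: "finite E" "E \<subseteq> L i ` V" "L i ` V \<subseteq> span E"
    using findim_basis[of "L i ` V"] insert.prems(3)[of i] by blast
  then obtain C where C: "finite C" "C \<subseteq> V" "E = L i ` C" using finite_subset_image by metis
  have "v \<in> span (C \<union> F)" if v: "v \<in> V" for v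
  proof -
    have "L i v \<in> L i ` span C" using E(3) v C(3) linear_span_image[OF li, of C] by blast
    then obtain u where u: "u \<in> span C" "L i v = L i u" by blast
    have "u \<in> V" using u(1) C(2) insert.prems(1) span_minimal by blast
    then have "v - u \<in> K"
      unfolding K_def using v u(2) insert.prems(1) by (simp add: subspace_diff linear_diff[OF li])
    then have "v - u \<in> span (C \<union> F)" using F(2) span_mono[of F "C \<union> F"] by blast
    moreover have "u \<in> span (C \<union> F)" using u(1) span_mono[of C "C \<union> F"] by blast
    ultimately show ?thesis using span_add by fastforce
  qed
  then show ?case unfolding findim_def using C(1) F(1) by blast
qed

lemma dim_inj_on_image:
  assumes f: "linear f" and inj: "inj_on f (span S)"
  shows "dim (f ` S) = dim S"
proof -
  obtain E where E: "E \<subseteq> S" "independent E" "S \<subseteq> span E"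
    by (rule maximal_independent_subset)
  have injE: "inj_on f (span E)" using inj_on_subset[OF inj span_mono[OF E(1)]] .
  have "f ` S \<subseteq> span (f ` E)" using E(3) linear_span_image[OF f, of E] by blast
  moreover have "independent (f ` E)" by (rule linear_independent_injective_image[OF f E(2) injE])
  ultimately have "dim (f ` S) = card (f ` E)"
    using basis_card_eq_dim[OF image_mono[OF E(1), of f]] by simp
  also have "\<dots> = card E" by (rule card_image[OF inj_on_subset[OF injE span_superset]])
  also have "\<dots> = dim S" using basis_card_eq_dim[OF E(1,3,2)] .
  finally show ?thesis .
qed

lemma dim_inj_image_le:
  fixes f :: "'b::euclidean_space \<Rightarrow> 'a::real_vector"
  assumes "findim V" "linear f" "inj f" "range f \<subseteq> V"
  shows "DIM('b) \<le> dim V"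
proof -
  have ind: "independent (f ` Basis)"
    by (rule linear_independent_injective_image[OF assms(2) independent_Basis])
      (rule inj_on_subset[OF assms(3) subset_UNIV])
  obtain B where B: "f ` Basis \<subseteq> B" "B \<subseteq> V" "independent B" "V \<subseteq> span B"
    using maximal_independent_subset_extend[OF _ ind, of V] assms(4) by blast
  obtain F where F: "finite F" "V \<subseteq> span F" using assms(1) by (auto simp: findim_def)
  have fB: "finite B" using independent_span_bound[OF F(1) B(3)] B(2) F(2) by blast
  have "DIM('b) = card (f ` (Basis :: 'b set))"
    by (rule card_image[symmetric]) (rule inj_on_subset[OF assms(3) subset_UNIV])
  also have "\<dots> \<le> card B" using B(1) fB by (rule card_mono[rotated])
  also have "\<dots> = dim V" using basis_card_eq_dim[OF B(2,4,3)] by simp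
  finally show ?thesis .
qed

lemma span_UN_decompose:
  fixes G :: "int \<Rightarrow> 'a::real_vector set"
  assumes sub: "\<And>p. subspace (G p)" and q: "q \<in> span (\<Union>p\<in>I. G p)"
  obtains S x where "finite S" "S \<subseteq> I" "\<And>p. x p \<in> G p" "q = (\<Sum>p\<in>S. x p)"
proof -
  have "\<exists>S x. finite S \<and> S \<subseteq> I \<and> (\<forall>p. x p \<in> G p) \<and> q = (\<Sum>p\<in>S. x p)"
    using q
  proof (induction rule: span_induct_alt)
    case base
    show ?case by (rule exI[of _ "{}"], rule exI[of _ "\<lambda>_. 0"]) (simp add: subspace_0[OF sub])
  next
    case (step c b u)
    then obtain S x p where S: "finite S" "S \<subseteq> I" "\<forall>p. x p \<in> G p" "u = (\<Sum>p\<in>S. x p)"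
      and p: "p \<in> I" "b \<in> G p" by blast
    let ?x = "\<lambda>r. (if r \<in> S then x r else 0) + (if r = p then c *\<^sub>R b else 0)"
    have "(\<Sum>r\<in>insert p S. ?x r) = u + c *\<^sub>R b"
      using S(1) unfolding sum.distrib S(4)
      by (auto intro!: sum.mono_neutral_cong_right simp: sum.delta)
    moreover have "?x r \<in> G r" for r
      using S(3) p(2) by (auto simp: subspace_0[OF sub] subspace_scale[OF sub] intro!: subspace_add[OF sub])
    ultimately show ?case
      using S(1,2) p(1) by (intro exI[of _ "insert p S"] exI[of _ ?x]) (auto simp: add.commute)
  qed
  then show ?thesis using that by blast
qed

lemma bilinear_span:
  assumes b: "bilinear b" and V: "subspace V" and S: "\<And>x y. x \<in> S \<Longrightarrow> y \<in> R \<Longrightarrow> b x y \<in> V"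
    and x: "x \<in> span S" and y: "y \<in> span R"
  shows "b x y \<in> V"
proof -
  have 1: "b u y \<in> V" if "u \<in> S" for u
    using y
  proof (rule span_induct)
    show "subspace {y. b u y \<in> V}"
      using b V by (auto simp: bilinear_def intro: linear_subspace_vimage[unfolded vimage_def])
  qed (use that S in auto)
  show ?thesis
    using x
  proof (rule span_induct)
    show "subspace {x. b x y \<in> V}"
      using b V linear_subspace_vimage[of "\<lambda>x. b x y" V] by (simp add: bilinear_def vimage_def)
  qed (use 1 in auto)
qed

lemma lookup_scaleR: "Poly_Mapping.lookup (c *\<^sub>R p) n = c *\<^sub>R Poly_Mapping.lookup p n"
  for p :: "('a, real) poly_mapping"
proof -
  have "finite {i. c *\<^sub>R Poly_Mapping.lookup p i \<noteq> 0}"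
    by (rule finite_subset[OF _ finite_lookup[of p]]) auto
  then show ?thesis
    unfolding scaleR_poly_mapping_def by (subst lookup_Abs_poly_mapping) auto
qed

lemma independent_poly_mapping_single:
  "independent (range (\<lambda>n. Poly_Mapping.single n (1::real)))"
proof -
  let ?e = "\<lambda>n::'a. Poly_Mapping.single n (1::real)"
  have "?e n \<notin> span (range ?e - {?e n})" for n
  proof
    let ?Z = "{p. Poly_Mapping.lookup p n = 0} :: ('a, real) poly_mapping set"
    assume "?e n \<in> span (range ?e - {?e n})"
    moreover have "subspace ?Z"
      by (auto simp: subspace_def lookup_add lookup_scaleR)
    moreover have "range ?e - {?e n} \<subseteq> ?Z"
      by (auto simp: lookup_single when_def)
    ultimately have "?e n \<in> ?Z" using span_minimal by blast
    then show False by (simp add: lookup_single)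
  qed
  then show ?thesis unfolding dependent_def by blast
qed

text \<open>
  The maximality hypothesis only speaks of prolongations inside the space of finitely supported real
  sequences; any space of countable dimension can be moved there.
\<close>

lemma countable_span_embedding:
  fixes C :: "'a::real_vector set"
  assumes "countable C"
  obtains h :: "'a \<Rightarrow> (nat, real) poly_mapping" where "linear h" "inj_on h (span C)"
proof -
  obtain B where B: "B \<subseteq> C" "independent B" "C \<subseteq> span B"
    by (rule maximal_independent_subset)
  define e where "e b = Poly_Mapping.single (to_nat_on B b) (1::real)" for b
  have inj: "inj_on e B"
  proof (rule inj_onI)
    fix a b assume "a \<in> B" "b \<in> B" "e a = e b"
    then have "Poly_Mapping.lookup (e b) (to_nat_on B a) = 1"
      by (metis e_def lookup_single_eq)
    then have "to_nat_on B a = to_nat_on B b"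
      unfolding e_def lookup_single when_def by (metis zero_neq_one)
    then show "a = b"
      using \<open>a \<in> B\<close> \<open>b \<in> B\<close> countable_subset[OF B(1) assms] by simp
  qed
  obtain h where h: "linear h" "\<forall>x\<in>B. h x = e x"
    using linear_independent_extend[OF B(2), of e] by blast
  have img: "h ` B = e ` B" using h(2) by auto
  have "e ` B \<subseteq> range (\<lambda>n. Poly_Mapping.single n (1::real))"
    unfolding e_def by blast
  then have "independent (h ` B)"
    unfolding img using independent_mono[OF independent_poly_mapping_single] by blast
  moreover have "inj_on h B" using inj h(2) by (metis inj_on_cong)
  ultimately have "inj_on h (span B)"
    using linear_inj_on_span_independent_image[OF h(1)] by blast
  moreover have "span C = span B"
    using span_mono[OF B(1)] span_minimal[OF B(3) subspace_span] by (rule equalityI[rotated])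
  ultimately show ?thesis using that h(1) by simp
qed

section \<open>The Lie algebra of jets\<close>

type_synonym 'm jet = "'m list \<Rightarrow> 'm"

definition shift :: "'m \<Rightarrow> 'm jet \<Rightarrow> 'm jet" where
  "shift y P = (\<lambda>w. P (y # w))"

text \<open>
  Writing \<open>P [y1, ..., yn]\<close> for the value at the element \<open>y1 ... yn\<close> of the tensor algebra, these are
  the linear maps that factor through the universal enveloping algebra.
\<close>

definition coinduced :: "('m::real_vector \<Rightarrow> 'm \<Rightarrow> 'm) \<Rightarrow> 'm jet \<Rightarrow> bool" where
  "coinduced B P \<longleftrightarrow>
     (\<forall>a b. linear (\<lambda>y. P (a @ y # b))) \<and>
     (\<forall>a y y' b. P (a @ y # y' # b) - P (a @ y' # y # b) = P (a @ B y y' # b))"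

text \<open>
  The second clause is Leibniz' rule: if \<open>P\<close> is the jet of \<open>x\<close>, then \<open>shift y P\<close> is the jet of \<open>[x, y]\<close>.
  In the first clause \<open>P [v]\<close> is the \<open>\<mm>\<^sub>-\<close>-part of \<open>[x, v]\<close>. Splitting \<open>x = a + x'\<close> and \<open>y = b + y'\<close> into
  the parts in \<open>\<mm>\<^sub>-\<close> and in non-negative degree, \<open>[x, b] - [y, a]\<close> counts \<open>[a, b]\<close> twice and omits only
  \<open>[x', y']\<close>, which has no \<open>\<mm>\<^sub>-\<close>-part.
\<close>

fun jet_bracket :: "('m::real_vector \<Rightarrow> 'm \<Rightarrow> 'm) \<Rightarrow> 'm jet \<Rightarrow> 'm jet \<Rightarrow> 'm jet" where
  "jet_bracket B P Q [] = P [Q []] - Q [P []] - B (P []) (Q [])"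
| "jet_bracket B P Q (y # w) = jet_bracket B (shift y P) Q w + jet_bracket B P (shift y Q) w"

definition adjoint_jet :: "('m \<Rightarrow> 'm \<Rightarrow> 'm) \<Rightarrow> 'm \<Rightarrow> 'm jet" where
  "adjoint_jet B v = foldl B v"

text \<open>
  A jet without \<open>\<mm>\<^sub>-\<close>-part, given by its shifts. All jets of degree at least 0 arise in this way.
\<close>

definition cons_jet :: "('m::real_vector \<Rightarrow> 'm jet) \<Rightarrow> 'm jet" where
  "cons_jet F = (\<lambda>w. case w of [] \<Rightarrow> 0 | y # w' \<Rightarrow> F y w')"

definition derivation_jet :: "('m::real_vector \<Rightarrow> 'm \<Rightarrow> 'm) \<Rightarrow> ('m \<Rightarrow> 'm) \<Rightarrow> 'm jet" where
  "derivation_jet B D = cons_jet (\<lambda>y. adjoint_jet B (D y))"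

lemma shift_apply: "shift y P w = P (y # w)"
  by (simp add: shift_def)

lemma shift_add [simp]: "shift y (P + Q) = shift y P + shift y Q"
  by (simp add: fun_eq_iff shift_apply)

lemma shift_zero [simp]: "shift y 0 = 0"
  by (simp add: fun_eq_iff shift_apply)

lemma shift_scaleR [simp]: "shift y (r *\<^sub>R P) = r *\<^sub>R shift y P"
  by (simp add: fun_eq_iff shift_apply)

lemma linear_shift: "linear (shift y)"
  by (rule linearI) simp_all

lemma shift_jet_bracket:
  "shift y (jet_bracket B P Q) = jet_bracket B (shift y P) Q + jet_bracket B P (shift y Q)"
  by (simp add: fun_eq_iff shift_apply)

lemma shift_adjoint_jet [simp]: "shift y (adjoint_jet B v) = adjoint_jet B (B v y)"
  by (simp add: fun_eq_iff shift_apply adjoint_jet_def)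

lemma shift_cons_jet [simp]: "shift y (cons_jet F) = F y"
  by (simp add: fun_eq_iff shift_apply cons_jet_def)

lemma shift_derivation_jet [simp]: "shift y (derivation_jet B D) = adjoint_jet B (D y)"
  by (simp add: derivation_jet_def)

lemma adjoint_jet_Nil [simp]: "adjoint_jet B v [] = v"
  by (simp add: adjoint_jet_def)

lemma cons_jet_Nil [simp]: "cons_jet F [] = 0"
  by (simp add: cons_jet_def)

lemma derivation_jet_Nil [simp]: "derivation_jet B D [] = 0"
  by (simp add: derivation_jet_def)

lemma cons_jet_add: "cons_jet (\<lambda>y. F y + F' y) = cons_jet F + cons_jet F'"
  by (simp add: fun_eq_iff cons_jet_def split: list.split)

lemma cons_jet_scaleR: "cons_jet (\<lambda>y. r *\<^sub>R F y) = r *\<^sub>R cons_jet F"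
  by (simp add: fun_eq_iff cons_jet_def split: list.split)

text \<open>
  The condition at the front of a word, together with the same for all shifts, is what inductions over
  words and over degrees can use.
\<close>

lemma coinduced_iff:
  "coinduced B P \<longleftrightarrow>
     linear (\<lambda>y. shift y P) \<and>
     (\<forall>y y'. shift y' (shift y P) - shift y (shift y' P) = shift (B y y') P) \<and>
     (\<forall>y. coinduced B (shift y P))"
    (is "_ = (?lin \<and> ?swap \<and> ?rec)")
proof (intro iffI conjI)
  assume P: "coinduced B P"
  note lin = P[unfolded coinduced_def, THEN conjunct1, rule_format]
  note swap = P[unfolded coinduced_def, THEN conjunct2, rule_format]
  show ?lin unfolding linear_fun_iff shift_apply using lin[of "[]"] by (simp only: append_Nil simp_thms)
  show ?swap unfolding fun_eq_iff fun_diff_def shift_apply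
    using swap[of "[]"] by (simp only: append_Nil simp_thms)
  show ?rec
  proof
    fix z
    have "linear (\<lambda>y. P (z # a @ y # b))" for a b using lin[of "z # a" b] by (simp only: append_Cons)
    moreover have "P (z # a @ y # y' # b) - P (z # a @ y' # y # b) = P (z # a @ B y y' # b)" for a y y' b
      using swap[of "z # a" y y' b] by (simp only: append_Cons)
    ultimately show "coinduced B (shift z P)" unfolding coinduced_def shift_apply by blast
  qed
next
  assume r: "?lin \<and> ?swap \<and> ?rec"
  have "linear (\<lambda>y. P (a @ y # b))" for a b
  proof (cases a)
    case Nil
    show ?thesis unfolding Nil append_Nil using r by (simp only: linear_fun_iff shift_apply)
  next
    case (Cons z a')
    show ?thesis unfolding Cons append_Cons using r by (simp only: coinduced_def shift_apply simp_thms)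
  qed
  moreover have "P (a @ y # y' # b) - P (a @ y' # y # b) = P (a @ B y y' # b)" for a y y' b
  proof (cases a)
    case Nil
    show ?thesis unfolding Nil append_Nil using r by (simp only: fun_eq_iff fun_diff_def shift_apply)
  next
    case (Cons z a')
    show ?thesis unfolding Cons append_Cons using r by (simp only: coinduced_def shift_apply simp_thms)
  qed
  ultimately show "coinduced B P" unfolding coinduced_def by blast
qed

lemma coinduced_cons_jet:
  assumes "linear F" "\<And>y y'. shift y' (F y) - shift y (F y') = F (B y y')" "\<And>y. coinduced B (F y)"
  shows "coinduced B (cons_jet F)"
  unfolding coinduced_iff[of B "cons_jet F"] shift_cons_jet using assms by blast

lemma coinduced_shift: "coinduced B P \<Longrightarrow> coinduced B (shift y P)"
  using coinduced_iff by blast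

lemma coinduced_swap:
  assumes "coinduced B P"
  shows "shift y' (shift y P) = shift y (shift y' P) + shift (B y y') P"
proof -
  have "shift y' (shift y P) - shift y (shift y' P) = shift (B y y') P"
    using assms coinduced_iff[of B P] by blast
  then show ?thesis by (simp only: diff_eq_eq add.commute)
qed

lemma coinduced_swap_apply:
  assumes "coinduced B P"
  shows "P (y # y' # w) = P (y' # y # w) + P (B y y' # w)"
  using fun_cong[OF coinduced_swap[OF assms], of y' y w] by (simp add: shift_apply)

lemma coinduced_linear_shift: "coinduced B P \<Longrightarrow> linear (\<lambda>y. shift y P)"
  using coinduced_iff by blast

lemma coinduced_linear: "coinduced B P \<Longrightarrow> linear (\<lambda>y. P (y # w))"
  using coinduced_linear_shift[of B P] by (simp add: linear_fun_iff shift_apply)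

lemma coinduced_linear_comp:
  assumes "coinduced B P" "linear f" shows "linear (\<lambda>x. P (f x # w))"
  using linear_compose[OF assms(2) coinduced_linear[OF assms(1)]] by (simp add: o_def)

lemma subspace_coinduced: "subspace {P. coinduced B P}"
proof (rule subspaceI)
  show "0 \<in> {P. coinduced B P}" by (simp add: coinduced_def linear_zero)
  show "P + Q \<in> {P. coinduced B P}" if "P \<in> {P. coinduced B P}" "Q \<in> {P. coinduced B P}" for P Q
  proof -
    have "linear (\<lambda>y. P (a @ y # b) + Q (a @ y # b))" for a b
      using that by (intro linear_compose_add) (simp_all only: coinduced_def mem_Collect_eq)
    moreover have "P (a @ y # y' # b) + Q (a @ y # y' # b) - (P (a @ y' # y # b) + Q (a @ y' # y # b)) =
        P (a @ B y y' # b) + Q (a @ B y y' # b)" for a y y' b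
      using that unfolding add_diff_add by (simp only: coinduced_def mem_Collect_eq)
    ultimately show ?thesis unfolding coinduced_def mem_Collect_eq plus_fun_apply by blast
  qed
  show "r *\<^sub>R P \<in> {P. coinduced B P}" if "P \<in> {P. coinduced B P}" for r P
  proof -
    have "linear (\<lambda>y. r *\<^sub>R P (a @ y # b))" for a b
      using that by (intro linear_compose_scale_right) (simp only: coinduced_def mem_Collect_eq)
    moreover have "r *\<^sub>R P (a @ y # y' # b) - r *\<^sub>R P (a @ y' # y # b) = r *\<^sub>R P (a @ B y y' # b)" for a y y' b
      unfolding scaleR_right_diff_distrib[symmetric] using that by (simp only: coinduced_def mem_Collect_eq)
    ultimately show ?thesis unfolding coinduced_def mem_Collect_eq scaleR_fun_apply by blast
  qed
qed

locale lie_bracket =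
  fixes B :: "'m::real_vector \<Rightarrow> 'm \<Rightarrow> 'm"
  assumes lie: "real_lie_algebra UNIV B"
begin

lemma bilinear: "bilinear B"
  using real_lie_algebra.bilinear[OF lie] .

lemma linear_right: "linear (B x)" and linear_left: "linear (\<lambda>x. B x y)"
  using bilinear by (auto simp: bilinear_def)

lemma antisym: "B x y = - B y x"
proof -
  have "B (x + y) (x + y) = 0" "B x x = 0" "B y y = 0"
    using real_lie_algebra.alternating[OF lie] by auto
  then have "B x y + B y x = 0"
    by (simp add: linear_add[OF linear_right] linear_add[OF linear_left] add.commute)
  then show ?thesis by (rule eq_neg_iff_add_eq_0[THEN iffD2])
qed

lemma ad_derivation: "B (B x y) z = B (B x z) y + B x (B y z)"
proof -
  have "B x (B y z) + B y (B z x) + B z (B x y) = 0"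
    using real_lie_algebra.Jacobi[OF lie] by auto
  moreover have "B z (B x y) = - B (B x y) z" by (rule antisym)
  moreover have "B y (B z x) = B (B x z) y"
    using antisym[of z x] antisym[of y "B x z"] by (simp add: linear_neg[OF linear_right])
  ultimately have "B x (B y z) + B (B x z) y - B (B x y) z = 0" by simp
  then show ?thesis by (simp only: right_minus_eq add.commute)
qed

lemma linear_adjoint_jet: "linear (adjoint_jet B)"
  unfolding linear_fun_iff
proof
  show "linear (\<lambda>v. adjoint_jet B v w)" for w
  proof (induction w)
    case (Cons y w)
    then show ?case using linear_compose[OF linear_left[of y] Cons] by (simp add: adjoint_jet_def o_def)
  qed (simp add: linear_id[unfolded id_def])
qed

lemma coinduced_adjoint_jet: "coinduced B (adjoint_jet B v)"
proof -
  have "linear (\<lambda>y. adjoint_jet B v (a @ y # b))" for a b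
    using linear_compose[OF linear_right[of "foldl B v a"] linear_adjoint_jet[unfolded linear_fun_iff, rule_format, of b]]
    by (simp add: adjoint_jet_def o_def)
  moreover have "adjoint_jet B v (a @ y # y' # b) - adjoint_jet B v (a @ y' # y # b) =
      adjoint_jet B v (a @ B y y' # b)" for a y y' b
  proof -
    let ?u = "foldl B v a"
    have "adjoint_jet B (B (B ?u y) y') b = adjoint_jet B (B (B ?u y') y) b + adjoint_jet B (B ?u (B y y')) b"
      using arg_cong[OF ad_derivation, of "\<lambda>x. adjoint_jet B x b" ?u y y']
      by (simp add: linear_add[OF linear_adjoint_jet])
    then show ?thesis by (simp add: adjoint_jet_def)
  qed
  ultimately show ?thesis by (simp add: coinduced_def)
qed

lemma derivation_jet_zero: "derivation_jet B (\<lambda>y. 0) = 0"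
  by (simp add: derivation_jet_def linear_0[OF linear_adjoint_jet] cons_jet_def fun_eq_iff split: list.split)

lemma derivation_jet_add: "derivation_jet B (\<lambda>y. D y + E y) = derivation_jet B D + derivation_jet B E"
  by (simp only: derivation_jet_def linear_add[OF linear_adjoint_jet] cons_jet_add)

lemma derivation_jet_scaleR: "derivation_jet B (\<lambda>y. r *\<^sub>R D y) = r *\<^sub>R derivation_jet B D"
  by (simp only: derivation_jet_def linear_scale[OF linear_adjoint_jet] cons_jet_scaleR)

lemma coinduced_derivation_jet:
  assumes "linear D" "\<And>x y. D (B x y) = B (D x) y + B x (D y)"
  shows "coinduced B (derivation_jet B D)"
  unfolding derivation_jet_def
proof (rule coinduced_cons_jet)
  show "linear (\<lambda>y. adjoint_jet B (D y))"
    using linear_compose[OF assms(1) linear_adjoint_jet] by (simp add: o_def)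
  show "shift y' (adjoint_jet B (D y)) - shift y (adjoint_jet B (D y')) = adjoint_jet B (D (B y y'))" for y y'
    unfolding shift_adjoint_jet assms(2) using antisym[of y "D y'"]
    by (simp flip: linear_diff[OF linear_adjoint_jet])
  show "coinduced B (adjoint_jet B (D y))" for y by (rule coinduced_adjoint_jet)
qed

lemma jet_bracket_linear_left:
  assumes "coinduced B Q" shows "linear (\<lambda>P. jet_bracket B P Q)"
  unfolding linear_fun_iff
proof
  show "linear (\<lambda>P. jet_bracket B P Q w)" for w
    using assms
  proof (induction w arbitrary: Q)
    case Nil
    have "linear (\<lambda>P :: 'm jet. P [])" by simp
    from coinduced_linear_comp[OF Nil this] linear_compose[OF this linear_left]
    show ?case by (auto intro!: linear_compose_sub simp: o_def)
  next
    case (Cons y w)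
    have "linear (\<lambda>P. jet_bracket B (shift y P) Q w)"
      using linear_compose[OF linear_shift Cons.IH[OF Cons.prems]] by (simp add: o_def)
    then show ?case
      using Cons.IH[OF coinduced_shift[OF Cons.prems]] by (auto intro!: linear_compose_add)
  qed
qed

lemma jet_bracket_antisym: "jet_bracket B P Q w = - jet_bracket B Q P w"
proof (induction w arbitrary: P Q)
  case Nil
  then show ?case using antisym[of "P []" "Q []"] by simp
next
  case (Cons y w)
  show ?case by (simp add: Cons[of "shift y P"] Cons[of P "shift y Q"])
qed

lemma jet_bracket_linear_right:
  assumes "coinduced B P" shows "linear (jet_bracket B P)"
proof -
  have "jet_bracket B P = (\<lambda>Q. - jet_bracket B Q P)"
    by (intro ext, unfold fun_Compl_def) (rule jet_bracket_antisym)
  then show ?thesis using linear_compose_neg[OF jet_bracket_linear_left[OF assms]] by simp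
qed

lemma coinduced_jet_bracket:
  assumes "coinduced B P" "coinduced B Q"
  shows "coinduced B (jet_bracket B P Q)"
proof -
  have 1: "linear (\<lambda>y. jet_bracket B P Q (a @ y # b))" for a b
    using assms
  proof (induction a arbitrary: P Q)
    case Nil
    show ?case
      using linear_compose[OF coinduced_linear_shift[OF Nil(1)] jet_bracket_linear_left[OF Nil(2)]]
        linear_compose[OF coinduced_linear_shift[OF Nil(2)] jet_bracket_linear_right[OF Nil(1)]]
      by (auto intro!: linear_compose_add simp: o_def linear_fun_iff)
  next
    case (Cons z a)
    then show ?case by (auto intro!: linear_compose_add simp: coinduced_shift)
  qed
  have 2: "jet_bracket B P Q (a @ y # y' # b) - jet_bracket B P Q (a @ y' # y # b) =
      jet_bracket B P Q (a @ B y y' # b)" for a y y' b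
    using assms
  proof (induction a arbitrary: P Q)
    case Nil
    show ?case
      by (simp add: coinduced_swap[OF Nil(1), of y' y] coinduced_swap[OF Nil(2), of y' y]
          linear_add[OF jet_bracket_linear_left[OF Nil(2)]] linear_add[OF jet_bracket_linear_right[OF Nil(1)]])
  next
    case (Cons z a)
    have "jet_bracket B (shift z P) Q (a @ y # y' # b) - jet_bracket B (shift z P) Q (a @ y' # y # b) =
      jet_bracket B (shift z P) Q (a @ B y y' # b)"
      "jet_bracket B P (shift z Q) (a @ y # y' # b) - jet_bracket B P (shift z Q) (a @ y' # y # b) =
      jet_bracket B P (shift z Q) (a @ B y y' # b)"
      using Cons by (auto simp: coinduced_shift)
    then show ?case by (simp add: algebra_simps)
  qed
  show ?thesis unfolding coinduced_def using 1 2 by blast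
qed

text \<open>
  By Leibniz' rule the cyclic sum at \<open>y # w\<close> is the sum of three cyclic sums at \<open>w\<close>, so only the empty
  word needs a computation. There the terms \<open>P [Q [R []]]\<close> cancel in pairs, the second order terms
  cancel because the jets respect commutators, and the Jacobi identity of \<open>B\<close> does the rest.
\<close>

lemma jet_bracket_Jacobi:
  assumes "coinduced B P" "coinduced B Q" "coinduced B R"
  shows "jet_bracket B P (jet_bracket B Q R) + jet_bracket B Q (jet_bracket B R P)
    + jet_bracket B R (jet_bracket B P Q) = 0"
proof -
  have "jet_bracket B P (jet_bracket B Q R) w + jet_bracket B Q (jet_bracket B R P) w
    + jet_bracket B R (jet_bracket B P Q) w = 0" for w
    using assms
  proof (induction w arbitrary: P Q R)
    case Nil
    note lin = linear_add[OF coinduced_linear] linear_diff[OF coinduced_linear]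
    let ?a = "P []" and ?b = "Q []" and ?c = "R []"
    have sw: "X [x, y] = X [y, x] + X [B x y]" if "coinduced B X" for X x y
      by (rule coinduced_swap_apply[OF that])
    have J: "B ?a (B ?b ?c) + B ?b (B ?c ?a) + B ?c (B ?a ?b) = 0"
      using real_lie_algebra.Jacobi[OF lie] by auto
    have anti: "B (P [?b]) ?c = - B ?c (P [?b])" "B (P [?c]) ?b = - B ?b (P [?c])"
      "B (Q [?a]) ?c = - B ?c (Q [?a])" "B (Q [?c]) ?a = - B ?a (Q [?c])"
      "B (R [?a]) ?b = - B ?b (R [?a])" "B (R [?b]) ?a = - B ?a (R [?b])"
      using antisym by blast+
    show ?case
      using J
      by (simp add: shift_apply lin[OF Nil(1)] lin[OF Nil(2)] lin[OF Nil(3)] anti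
          sw[OF Nil(1), of ?b ?c] sw[OF Nil(2), of ?c ?a] sw[OF Nil(3), of ?a ?b]
          linear_add[OF linear_right] linear_diff[OF linear_right] linear_neg[OF linear_right]
          algebra_simps)
  next
    case (Cons y w)
    have e: "jet_bracket B X (jet_bracket B Y Z) (y # w) =
      jet_bracket B (shift y X) (jet_bracket B Y Z) w + jet_bracket B X (jet_bracket B (shift y Y) Z) w
      + jet_bracket B X (jet_bracket B Y (shift y Z)) w" if "coinduced B X" for X Y Z
      by (simp add: shift_jet_bracket linear_add[OF jet_bracket_linear_right[OF that]] add.assoc)
    note IH = Cons.IH[OF coinduced_shift[OF Cons.prems(1), of y] Cons.prems(2,3)]
      Cons.IH[OF Cons.prems(1) coinduced_shift[OF Cons.prems(2), of y] Cons.prems(3)]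
      Cons.IH[OF Cons.prems(1,2) coinduced_shift[OF Cons.prems(3), of y]]
    have "(p1 + p2 + p3) + (q1 + q2 + q3) + (r1 + r2 + r3) = 0"
      if "p1 + q3 + r2 = 0" "p2 + q1 + r3 = 0" "p3 + q2 + r1 = 0"
      for p1 p2 p3 q1 q2 q3 r1 r2 r3 :: 'm
    proof -
      have "(p1 + p2 + p3) + (q1 + q2 + q3) + (r1 + r2 + r3) =
          (p1 + q3 + r2) + (p2 + q1 + r3) + (p3 + q2 + r1)" by (simp only: ac_simps)
      then show ?thesis unfolding that by simp
    qed
    from this[OF IH] show ?case
      unfolding e[OF Cons.prems(1)] e[OF Cons.prems(2)] e[OF Cons.prems(3)] .
  qed
  then show ?thesis by (simp add: fun_eq_iff)
qed

text \<open>
  The two terms of the recursion combine to a single shift because \<open>P\<close> respects commutators. Hence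
  conditions on shifts, as in the definition of \<open>tanaka\<close> below, are conditions on brackets with \<open>\<mm>\<^sub>-\<close>.
\<close>

lemma jet_bracket_adjoint_jet:
  assumes "coinduced B P" shows "jet_bracket B P (adjoint_jet B v) = shift v P"
proof -
  have "jet_bracket B P (adjoint_jet B v) w = shift v P w" for w
    using assms
  proof (induction w arbitrary: P v)
    case Nil
    show ?case using antisym[of v "P []"] by (simp add: shift_apply adjoint_jet_def)
  next
    case (Cons y w)
    have "P (v # y # w) = P (y # v # w) + P (B v y # w)"
      by (rule coinduced_swap_apply[OF Cons.prems])
    then show ?case
      unfolding jet_bracket.simps shift_adjoint_jet Cons.IH[OF coinduced_shift[OF Cons.prems]]
        Cons.IH[OF Cons.prems] shift_apply by simp
  qed
  then show ?thesis by (simp add: fun_eq_iff)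
qed

lemma jet_bracket_derivation_jets:
  assumes "linear D" "\<And>x y. D (B x y) = B (D x) y + B x (D y)"
    and "linear E" "\<And>x y. E (B x y) = B (E x) y + B x (E y)"
  shows "jet_bracket B (derivation_jet B D) (derivation_jet B E) = derivation_jet B (\<lambda>x. D (E x) - E (D x))"
proof
  fix w
  note co = coinduced_derivation_jet[OF assms(1,2)] coinduced_derivation_jet[OF assms(3,4)]
  show "jet_bracket B (derivation_jet B D) (derivation_jet B E) w = derivation_jet B (\<lambda>x. D (E x) - E (D x)) w"
  proof (cases w)
    case Nil
    then show ?thesis
      using linear_0[OF coinduced_linear[OF co(1)]] linear_0[OF coinduced_linear[OF co(2)]]
        linear_0[OF linear_right]
      by simp
  next
    case (Cons y w')
    have "jet_bracket B (derivation_jet B D) (derivation_jet B E) w =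
        jet_bracket B (derivation_jet B D) (adjoint_jet B (E y)) w'
        - jet_bracket B (derivation_jet B E) (adjoint_jet B (D y)) w'"
      using jet_bracket_antisym[of "adjoint_jet B (D y)" "derivation_jet B E" w'] by (simp add: Cons)
    also have "\<dots> = adjoint_jet B (D (E y) - E (D y)) w'"
      by (simp add: jet_bracket_adjoint_jet co linear_diff[OF linear_adjoint_jet])
    also have "\<dots> = derivation_jet B (\<lambda>x. D (E x) - E (D x)) w"
      by (simp add: Cons derivation_jet_def cons_jet_def)
    finally show ?thesis .
  qed
qed

end

section \<open>The universal transitive prolongation\<close>

text \<open>
  The recursion runs over natural numbers, so index \<open>m\<close> stands for degree \<open>m - 2\<close>.
\<close>

fun tanaka_nat :: "(complex^'n \<Rightarrow> complex^'n \<Rightarrow> complex^'k) \<Rightarrow> nat \<Rightarrow> ('n::finite, 'k::finite) neg jet set" where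
  "tanaka_nat H 0 = adjoint_jet (m_bracket H) ` m_deg (-2)"
| "tanaka_nat H (Suc 0) = adjoint_jet (m_bracket H) ` m_deg (-1)"
| "tanaka_nat H (Suc (Suc 0)) = (\<lambda>D. derivation_jet (m_bracket H) (blinfun_apply D)) ` m_zero H"
| "tanaka_nat H (Suc (Suc (Suc m))) = {P. coinduced (m_bracket H) P \<and> P [] = 0 \<and>
     (\<forall>z. shift (z, 0) P \<in> tanaka_nat H (Suc (Suc m))) \<and> (\<forall>t. shift (0, t) P \<in> tanaka_nat H (Suc m))}"

definition tanaka :: "(complex^'n \<Rightarrow> complex^'n \<Rightarrow> complex^'k) \<Rightarrow> int \<Rightarrow> ('n::finite, 'k::finite) neg jet set" where
  "tanaka H p = (if p < -2 then {0} else tanaka_nat H (nat (p + 2)))"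

lemma tanaka_pos:
  assumes "p > 0"
  shows "P \<in> tanaka H p \<longleftrightarrow> coinduced (m_bracket H) P \<and> P [] = 0 \<and>
     (\<forall>z. shift (z, 0) P \<in> tanaka H (p - 1)) \<and> (\<forall>t. shift (0, t) P \<in> tanaka H (p - 2))"
proof -
  obtain m where m: "p = int m + 1" using assms zero_less_imp_eq_int[of p] by (metis Suc_pred of_nat_Suc add.commute of_nat_0_less_iff)
  have "nat (p + 2) = Suc (Suc (Suc m))" "nat (p - 1 + 2) = Suc (Suc m)" "nat (p - 2 + 2) = Suc m"
    using m by auto
  then show ?thesis using assms by (simp add: tanaka_def del: One_nat_def)
qed

lemma tanaka_0: "tanaka H 0 = (\<lambda>D. derivation_jet (m_bracket H) (blinfun_apply D)) ` m_zero H"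
  by (simp add: tanaka_def numeral_2_eq_2)

lemma subspace_m_deg: "subspace (m_deg p)"
  by (auto simp: m_deg_def subspace_def zero_prod_def)

lemma hermitian_form_zero_right: "hermitian_form H \<Longrightarrow> H z 0 = 0"
  unfolding hermitian_form_def by (metis add_cancel_right_right add.right_neutral)

lemma linear_Im_vec: "linear Im_vec"
  by (rule linearI) (simp_all add: Im_vec_def vec_eq_iff)

lemma scaleR_eq_smult: "r *\<^sub>R x = complex_of_real r *s x" for x :: "complex^'n"
  by (simp add: vec_eq_iff scaleR_conv_of_real[of r "x $ i" for i])

lemma real_lie_algebra_m_bracket:
  assumes H: "hermitian_form H"
  shows "real_lie_algebra UNIV (m_bracket H)"
proof
  show "bilinear (m_bracket H)"
    unfolding bilinear_def
  proof (intro conjI allI linearI)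
    note h = H[unfolded hermitian_form_def]
    show "m_bracket H x (y + z) = m_bracket H x y + m_bracket H x z"
      "m_bracket H (y + z) x = m_bracket H y x + m_bracket H z x" for x y z
      using h by (auto simp: m_bracket_def linear_add[OF linear_Im_vec])
    show "m_bracket H x (r *\<^sub>R y) = r *\<^sub>R m_bracket H x y"
      "m_bracket H (r *\<^sub>R y) x = r *\<^sub>R m_bracket H y x" for x y r
      using h linear_scale[OF linear_Im_vec] by (auto simp: m_bracket_def scaleR_eq_smult)
  qed
  show "m_bracket H x x = 0" for x
    using H by (simp add: m_bracket_def hermitian_form_def Im_vec_def vec_eq_iff complex_is_Real_iff zero_prod_def)
  show "m_bracket H x (m_bracket H y z) + m_bracket H y (m_bracket H z x) + m_bracket H z (m_bracket H x y) = 0" for x y z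
    by (simp add: m_bracket_def hermitian_form_zero_right[OF H] linear_0[OF linear_Im_vec] zero_prod_def)
qed (simp_all add: subspace_UNIV)

locale fundamental_form =
  fixes H :: "complex^'n::finite \<Rightarrow> complex^'n \<Rightarrow> complex^'k::finite"
  assumes hermitian: "hermitian_form H" and fundamental: "fundamental H"

sublocale fundamental_form \<subseteq> lie_bracket "m_bracket H"
  by (rule lie_bracket.intro) (rule real_lie_algebra_m_bracket[OF hermitian])

context fundamental_form
begin

abbreviation "B \<equiv> m_bracket H"

lemma m_bracket_degree: "x \<in> m_deg p \<Longrightarrow> y \<in> m_deg q \<Longrightarrow> B x y \<in> m_deg (p + q)"
  using linear_0[OF linear_left[of y]] linear_0[OF linear_right[of x]]
  by (cases "p = -1 \<and> q = -1")
    (auto simp: m_deg_def m_bracket_def hermitian_form_zero_right[OF hermitian] linear_0[OF linear_Im_vec]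
      zero_prod_def split: if_splits)

lemma tanaka_neg:
  assumes "p < 0"
  shows "tanaka H p = adjoint_jet B ` m_deg p"
proof -
  consider "p < -2" | "p = -2" | "p = -1" using assms by linarith
  then show ?thesis
  proof cases
    case 1
    then show ?thesis by (simp add: tanaka_def m_deg_def linear_0[OF linear_adjoint_jet])
  qed (simp_all add: tanaka_def)
qed

lemma m_zero_derivation:
  assumes "D \<in> m_zero H"
  shows "linear (blinfun_apply D)" "blinfun_apply D (B x y) = B (blinfun_apply D x) y + B x (blinfun_apply D y)"
    "v \<in> m_deg p \<Longrightarrow> blinfun_apply D v \<in> m_deg p"
    "fst (blinfun_apply D (\<i> *s z, 0)) = \<i> *s fst (blinfun_apply D (z, 0))"
  using bounded_linear.linear[OF blinfun.bounded_linear_right] assms[unfolded m_zero_def mem_Collect_eq]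
  by blast+

lemma m_zeroI:
  assumes "\<And>x y. blinfun_apply D (B x y) = B (blinfun_apply D x) y + B x (blinfun_apply D y)"
    and "\<And>v p. v \<in> m_deg p \<Longrightarrow> blinfun_apply D v \<in> m_deg p"
    and "\<And>z. fst (blinfun_apply D (\<i> *s z, 0)) = \<i> *s fst (blinfun_apply D (z, 0))"
  shows "D \<in> m_zero H"
  unfolding m_zero_def using assms by blast

lemma tanaka_coinduced: "P \<in> tanaka H p \<Longrightarrow> coinduced B P"
proof -
  assume P: "P \<in> tanaka H p"
  consider "p < 0" | "p = 0" | "p > 0" by linarith
  then show ?thesis
  proof cases
    case 1 then show ?thesis using P tanaka_neg coinduced_adjoint_jet by auto
  next
    case 2 then show ?thesis
      using P m_zero_derivation by (auto simp: tanaka_0 intro!: coinduced_derivation_jet)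
  next
    case 3 then show ?thesis using P tanaka_pos by blast
  qed
qed

lemma tanaka_Nil: "P \<in> tanaka H p \<Longrightarrow> 0 \<le> p \<Longrightarrow> P [] = 0"
  using tanaka_pos[of p] by (cases "p = 0") (auto simp: tanaka_0)

lemma linear_derivation_jet: "linear (\<lambda>D. derivation_jet B (blinfun_apply D))"
  by (rule linearI)
    (simp_all only: plus_blinfun.rep_eq scaleR_blinfun.rep_eq derivation_jet_add derivation_jet_scaleR)

lemma subspace_m_zero: "subspace (m_zero H)"
proof (rule subspaceI)
  note add = linear_add[OF linear_left] linear_add[OF linear_right]
  note scale = linear_scale[OF linear_left] linear_scale[OF linear_right]
  show "0 \<in> m_zero H"
    by (rule m_zeroI)
      (simp_all add: linear_0[OF linear_left] linear_0[OF linear_right] subspace_0[OF subspace_m_deg])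
  show "D + E \<in> m_zero H" if DE: "D \<in> m_zero H" "E \<in> m_zero H" for D E
    by (rule m_zeroI)
      (simp_all add: blinfun.add_left add m_zero_derivation[OF DE(1)] m_zero_derivation[OF DE(2)]
        subspace_add[OF subspace_m_deg] vector_add_ldistrib)
  show "r *\<^sub>R D \<in> m_zero H" if D: "D \<in> m_zero H" for r D
    by (rule m_zeroI)
      (simp_all add: blinfun.scaleR_left scale m_zero_derivation[OF D] scaleR_add_right
        subspace_scale[OF subspace_m_deg] scaleR_eq_smult[where x = "_ :: complex^'n"]
        vector_smult_assoc mult.commute)
qed

lemma subspace_tanaka: "subspace (tanaka H p)"
proof (induction "nat p" arbitrary: p rule: less_induct)
  case less
  consider "p < 0" | "p = 0" | "p > 0" by linarith
  then show ?case
  proof cases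
    case 1 then show ?thesis
      by (simp add: tanaka_neg linear_subspace_image[OF linear_adjoint_jet] subspace_m_deg)
  next
    case 2 then show ?thesis
      using linear_subspace_image[OF linear_derivation_jet subspace_m_zero] by (simp add: tanaka_0)
  next
    case 3
    then have sub: "subspace (tanaka H (p - 1))" "subspace (tanaka H (p - 2))"
      using less by auto
    have "tanaka H p = {P. coinduced B P} \<inter> {P. P [] = 0} \<inter>
        (\<Inter>z. shift (z, 0) -` tanaka H (p - 1)) \<inter> (\<Inter>t. shift (0, t) -` tanaka H (p - 2))"
      using tanaka_pos[OF 3] by auto
    then show ?thesis
      using sub by (auto intro!: subspace_inter subspace_Inter subspace_coinduced
          linear_subspace_vimage[OF linear_shift] linear_subspace_kernel[OF linear_apply])
  qed
qed

lemma shift_m_deg: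
  assumes P: "P \<in> tanaka H p" and v: "v \<in> m_deg q"
  shows "shift v P \<in> tanaka H (p + q)"
proof (cases "q = -1 \<or> q = -2")
  case True
  consider "p < 0" | "p = 0" | "p > 0" by linarith
  then show ?thesis
  proof cases
    case 1
    then obtain u where u: "P = adjoint_jet B u" "u \<in> m_deg p"
      using P unfolding tanaka_neg[OF 1] by blast
    have "p + q < 0" using 1 True by linarith
    then show ?thesis using imageI[OF m_bracket_degree[OF u(2) v]] by (simp add: tanaka_neg u(1))
  next
    case 2
    then obtain D where D: "P = derivation_jet B (blinfun_apply D)" "D \<in> m_zero H"
      using P unfolding tanaka_0 2 by blast
    have "q < 0" using True by linarith
    then show ?thesis using imageI[OF m_zero_derivation(3)[OF D(2) v]] by (simp add: tanaka_neg D(1) 2)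
  next
    case 3
    then show ?thesis using P v True tanaka_pos[OF 3, of P H] by (auto simp: m_deg_def)
  qed
next
  case False
  then have "v = 0" using v by (auto simp: m_deg_def)
  then have "shift v P = 0"
    using linear_0[OF coinduced_linear_shift[OF tanaka_coinduced[OF P]]] by simp
  then show ?thesis using subspace_0[OF subspace_tanaka] by simp
qed

lemma m_zero_commutator:
  assumes D: "D \<in> m_zero H" and E: "E \<in> m_zero H"
  shows "(D o\<^sub>L E) - (E o\<^sub>L D) \<in> m_zero H"
proof -
  note * = m_zero_derivation[OF D] m_zero_derivation[OF E]
  have "blinfun_apply ((D o\<^sub>L E) - (E o\<^sub>L D)) (B x y) =
      B (blinfun_apply ((D o\<^sub>L E) - (E o\<^sub>L D)) x) y + B x (blinfun_apply ((D o\<^sub>L E) - (E o\<^sub>L D)) y)" for x y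
    by (simp add: blinfun.diff_left *(2,6) linear_add[OF *(1)] linear_add[OF *(5)]
        linear_diff[OF linear_left] linear_diff[OF linear_right])
  moreover have "blinfun_apply ((D o\<^sub>L E) - (E o\<^sub>L D)) v \<in> m_deg p" if "v \<in> m_deg p" for v p
    using *(3,7) that by (simp add: blinfun.diff_left subspace_diff[OF subspace_m_deg])
  moreover have "fst (blinfun_apply ((D o\<^sub>L E) - (E o\<^sub>L D)) (\<i> *s z, 0)) =
      \<i> *s fst (blinfun_apply ((D o\<^sub>L E) - (E o\<^sub>L D)) (z, 0))" for z
  proof -
    have form: "blinfun_apply F (z, 0) = (fst (blinfun_apply F (z, 0)), 0)" if "F \<in> m_zero H" for F z
      using m_zero_derivation(3)[OF that, of "(z, 0)" "-1"] by (auto simp: m_deg_def)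
    have J: "fst (blinfun_apply F (\<i> *s z, 0)) = \<i> *s fst (blinfun_apply F (z, 0))" if "F \<in> m_zero H" for F z
      using that by (simp add: m_zero_def)
    have "fst (blinfun_apply F (blinfun_apply F' (\<i> *s z, 0))) = \<i> *s fst (blinfun_apply F (blinfun_apply F' (z, 0)))"
      if "F \<in> m_zero H" "F' \<in> m_zero H" for F F' z
      by (subst (1 2) form[OF that(2)]) (simp add: J[OF that(1)] J[OF that(2)])
    then show ?thesis using D E by (simp add: blinfun.diff_left vector_sub_rdistrib vec_eq_iff algebra_simps)
  qed
  ultimately show ?thesis unfolding m_zero_def by (simp add: image_subset_iff)
qed

text \<open>
  The bracket with a jet of negative degree is a shift, and the bracket of two derivations is their
  commutator. In the remaining degrees the shifts of a bracket are sums of brackets of smaller total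
  degree.
\<close>

lemma tanaka_bracket:
  assumes "P \<in> tanaka H p" "Q \<in> tanaka H q"
  shows "jet_bracket B P Q \<in> tanaka H (p + q)"
proof -
  have right: "jet_bracket B P Q \<in> tanaka H (p + q)"
    if P: "P \<in> tanaka H p" and Q: "Q \<in> tanaka H q" and q: "q < 0" for P Q p q
  proof -
    obtain v where "Q = adjoint_jet B v" "v \<in> m_deg q" using Q unfolding tanaka_neg[OF q] by blast
    then show ?thesis
      using P by (simp add: jet_bracket_adjoint_jet tanaka_coinduced shift_m_deg)
  qed
  have left: "jet_bracket B P Q \<in> tanaka H (p + q)"
    if "P \<in> tanaka H p" "Q \<in> tanaka H q" "p < 0" for P Q p q
  proof -
    have "jet_bracket B P Q = - jet_bracket B Q P"
      by (intro ext, unfold fun_Compl_def) (rule jet_bracket_antisym)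
    then show ?thesis
      using right[OF that(2,1,3)] subspace_neg[OF subspace_tanaka] by (simp add: add.commute)
  qed
  show ?thesis
    using assms
  proof (induction "nat p + nat q" arbitrary: p q P Q rule: less_induct)
    case less
    consider "p < 0" | "q < 0" | "p = 0" "q = 0" | "p \<ge> 0" "q \<ge> 0" "p + q > 0" by linarith
    then show ?case
    proof cases
      case 1 then show ?thesis using left less.prems by blast
    next
      case 2 then show ?thesis using right less.prems by blast
    next
      case 3
      then obtain D E where DE: "P = derivation_jet B (blinfun_apply D)" "D \<in> m_zero H"
        "Q = derivation_jet B (blinfun_apply E)" "E \<in> m_zero H"
        using less.prems unfolding 3 tanaka_0 by blast
      have "blinfun_apply ((D o\<^sub>L E) - (E o\<^sub>L D)) =
          (\<lambda>x. blinfun_apply D (blinfun_apply E x) - blinfun_apply E (blinfun_apply D x))"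
        by (simp add: fun_eq_iff blinfun.diff_left)
      then have "jet_bracket B P Q = derivation_jet B (blinfun_apply ((D o\<^sub>L E) - (E o\<^sub>L D)))"
        using DE m_zero_derivation jet_bracket_derivation_jets by simp
      then show ?thesis using 3 m_zero_commutator[OF DE(2,4)] by (auto simp: tanaka_0)
    next
      case 4
      note co = tanaka_coinduced[OF less.prems(1)] tanaka_coinduced[OF less.prems(2)]
      have "jet_bracket B P Q [] = 0"
        using tanaka_Nil[OF less.prems(1) 4(1)] tanaka_Nil[OF less.prems(2) 4(2)]
          linear_0[OF coinduced_linear[OF co(1)]] linear_0[OF coinduced_linear[OF co(2)]]
          linear_0[OF linear_right]
        by simp
      moreover have sh: "shift v (jet_bracket B P Q) \<in> tanaka H (p + q + d)" if v: "v \<in> m_deg d" and d: "d < 0" for v d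
      proof -
        have "jet_bracket B (shift v P) Q \<in> tanaka H (p + d + q)"
        proof (cases "p + d < 0")
          case True then show ?thesis using left shift_m_deg[OF less.prems(1) v] less.prems(2) by blast
        next
          case False
          then show ?thesis using less.hyps[OF _ shift_m_deg[OF less.prems(1) v] less.prems(2)] 4 d by simp
        qed
        moreover have "jet_bracket B P (shift v Q) \<in> tanaka H (p + (q + d))"
        proof (cases "q + d < 0")
          case True then show ?thesis using right shift_m_deg[OF less.prems(2) v] less.prems(1) by blast
        next
          case False
          then show ?thesis using less.hyps[OF _ less.prems(1) shift_m_deg[OF less.prems(2) v]] 4 d by simp
        qed
        ultimately show ?thesis
          unfolding shift_jet_bracket using subspace_add[OF subspace_tanaka] by (simp add: ac_simps)
      qed
      moreover have "shift (z, 0) (jet_bracket B P Q) \<in> tanaka H (p + q - 1)" for z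
        using sh[of "(z, 0)" "-1"] by (simp add: m_deg_def)
      moreover have "shift (0, t) (jet_bracket B P Q) \<in> tanaka H (p + q - 2)" for t
        using sh[of "(0, t)" "-2"] by (simp add: m_deg_def)
      ultimately show ?thesis
        using tanaka_pos[OF 4(3)] coinduced_jet_bracket[OF co] by blast
    qed
  qed
qed

text \<open>
  Here the form being fundamental enters: \<open>[\<i> z, z] = H(z, z)\<close>, so \<open>\<mm>\<^sub>-\<^sub>1\<close> generates \<open>\<mm>\<^sub>-\<close>, and a jet that
  is killed by the shifts along \<open>\<mm>\<^sub>-\<^sub>1\<close> is killed by all shifts.
\<close>

lemma tanaka_transitive:
  assumes P: "P \<in> tanaka H p" "0 \<le> p" and z: "\<And>z. shift (z, 0) P = 0"
  shows "P = 0"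
proof -
  note co = tanaka_coinduced[OF P(1)]
  have "shift (0, t) P = 0" for t
  proof -
    have "t \<in> span (range (\<lambda>z. Re_vec (H z z)))"
      using fundamental by (simp add: fundamental_def)
    then show ?thesis
    proof (rule span_induct)
      have "linear (\<lambda>t. shift (0::complex^'n, t) P)"
        using linear_compose[OF _ coinduced_linear_shift[OF co], of "\<lambda>t. (0, t)"]
        by (simp add: o_def linear_iff)
      then show "subspace {t. shift (0::complex^'n, t) P = 0}" by (rule linear_subspace_kernel)
    next
      fix t assume "t \<in> range (\<lambda>z. Re_vec (H z z))"
      then obtain z where t: "t = Re_vec (H z z)" by blast
      have "B (\<i> *s z, 0) (z, 0) = (0, t)"
        using hermitian by (simp add: m_bracket_def t hermitian_form_def Im_vec_def Re_vec_def)
      then show "shift (0, t) P = 0"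
        using coinduced_swap[OF co, of "(z, 0)" "(\<i> *s z, 0)"] z by simp
    qed
  qed
  then have "shift (z, t) P = 0" for z t
    using linear_add[OF coinduced_linear_shift[OF co], of "(z, 0)" "(0, t)"] z by simp
  then have "P (y # w) = 0" for y w
    by (metis prod.collapse shift_apply zero_fun_apply)
  moreover have "P [] = 0" using tanaka_Nil P by blast
  ultimately have "P w = 0" for w by (cases w) auto
  then show ?thesis by (simp add: fun_eq_iff)
qed

text \<open>
  In a vanishing sum, the terms of negative degree are read off from the value at the empty word and
  therefore vanish. Shifting along \<open>\<mm>\<^sub>-\<^sub>1\<close> then lowers all other degrees by one, so that induction on the
  highest degree and transitivity apply.
\<close>

lemma tanaka_direct_sum:
  assumes S: "finite S" "\<And>p. p \<in> S \<Longrightarrow> x p \<in> tanaka H p" "(\<Sum>p\<in>S. x p) = 0" "q \<in> S"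
  shows "x q = 0"
proof -
  have *: "\<forall>p\<in>{-2..<int N}. x p = 0"
    if "\<And>p. x p \<in> tanaka H p" "(\<Sum>p\<in>{-2..<int N}. x p) = 0" for N x
    using that
  proof (induction N arbitrary: x)
    case 0
    have "{-2..<int 0} = {-2, -1}" by auto
    with fun_cong[OF 0(2), of "[]"] have s: "x (-2) [] + x (-1) [] = 0" by (simp add: sum_fun_apply)
    obtain v w where v: "x (-2) = adjoint_jet B v" "v \<in> m_deg (-2)"
      and w: "x (-1) = adjoint_jet B w" "w \<in> m_deg (-1)"
      using 0(1)[of "-2"] 0(1)[of "-1"] unfolding tanaka_neg[of "-2", simplified] tanaka_neg[of "-1", simplified] by blast
    have "v + w = 0" using s v w by simp
    then have "v = 0" "w = 0" using v(2) w(2) by (auto simp: m_deg_def zero_prod_def)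
    then have "x (-2) = 0" "x (-1) = 0" using v(1) w(1) linear_0[OF linear_adjoint_jet] by metis+
    then show ?case unfolding \<open>{-2..<int 0} = {-2, -1}\<close> by blast
  next
    case (Suc N)
    have I: "{-2..<int (Suc N)} = insert (-2) {-1..<int (Suc N)}" by auto
    have I': "{-1..<int (Suc N)} = (\<lambda>p. p + 1) ` {-2..<int N}"
      by (auto simp: image_iff intro!: bexI[of _ "_ - 1"])
    have nil: "x (-2) [] + x (-1) [] = 0"
    proof -
      have "{-2..<int (Suc N)} = {-2, -1} \<union> {0..<int (Suc N)}" by auto
      then have "(\<Sum>p\<in>{-2..<int (Suc N)}. x p []) = (\<Sum>p\<in>{-2, -1}. x p []) + (\<Sum>p\<in>{0..<int (Suc N)}. x p [])"
        by (simp only:) (rule sum.union_disjoint, auto)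
      moreover have "(\<Sum>p\<in>{0..<int (Suc N)}. x p []) = 0"
        using tanaka_Nil[OF Suc.prems(1)] by (intro sum.neutral) auto
      ultimately show ?thesis
        using fun_cong[OF Suc.prems(2), of "[]"] by (simp add: sum_fun_apply)
    qed
    obtain v w where v: "x (-2) = adjoint_jet B v" "v \<in> m_deg (-2)"
      and w: "x (-1) = adjoint_jet B w" "w \<in> m_deg (-1)"
      using Suc.prems(1)[of "-2"] Suc.prems(1)[of "-1"] unfolding tanaka_neg[of "-2", simplified] tanaka_neg[of "-1", simplified] by blast
    have "v = 0" "w = 0" using v w nil by (auto simp: m_deg_def zero_prod_def)
    then have neg: "x (-2) = 0" "x (-1) = 0" using v(1) w(1) linear_0[OF linear_adjoint_jet] by metis+
    have "shift (z, 0) (x (p + 1)) = 0" if "p \<in> {-2..<int N}" for z p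
    proof -
      have "(\<Sum>p\<in>{-2..<int N}. shift (z, 0) (x (p + 1))) = shift (z, 0) (\<Sum>p\<in>{-2..<int N}. x (p + 1))"
        by (rule linear_sum[OF linear_shift, symmetric])
      also have "(\<Sum>p\<in>{-2..<int N}. x (p + 1)) = (\<Sum>p\<in>{-1..<int (Suc N)}. x p)"
        unfolding I' by (subst sum.reindex) (auto simp: inj_on_def)
      also have "\<dots> = x (-2) + (\<Sum>p\<in>{-1..<int (Suc N)}. x p)" unfolding neg(1) add_0_left ..
      also have "\<dots> = 0"
        unfolding Suc.prems(2)[symmetric] I by (rule sum.insert[symmetric]) auto
      finally have "(\<Sum>p\<in>{-2..<int N}. shift (z, 0) (x (p + 1))) = 0" unfolding shift_zero .
      moreover have "shift (z, 0) (x (p + 1)) \<in> tanaka H p" for p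
        using shift_m_deg[OF Suc.prems(1), of "(z, 0)" "-1" "p + 1"] by (simp add: m_deg_def)
      ultimately show ?thesis using Suc.IH[of "\<lambda>p. shift (z, 0) (x (p + 1))"] that by blast
    qed
    then have *: "x (p + 1) = 0" if "p \<in> {-1..<int N}" for p
      using tanaka_transitive[OF Suc.prems(1), of "p + 1"] that by simp
    have pos: "x p = 0" if "p \<in> {0..<int (Suc N)}" for p
      using *[of "p - 1"] that by simp
    show ?case
    proof
      fix p assume "p \<in> {-2..<int (Suc N)}"
      then consider "p = -2" | "p = -1" | "p \<in> {0..<int (Suc N)}" by fastforce
      then show "x p = 0" by cases (use neg pos in blast)+
    qed
  qed
  define y where "y p = (if p \<in> S then x p else 0)" for p
  define N where "N = nat (Max S + 1)"
  have y: "y p \<in> tanaka H p" for p using S(2) subspace_0[OF subspace_tanaka] by (simp add: y_def)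
  have out: "y p = 0" if "p \<notin> S" for p using that by (simp add: y_def)
  have N: "p < int N" if "p \<in> S" for p
    using Max_ge[OF S(1) that] unfolding N_def by linarith
  have small: "y p = 0" if "p < -2" for p using y[of p] that by (simp add: tanaka_def)
  have "(\<Sum>p\<in>{-2..<int N}. y p) = (\<Sum>p\<in>S. y p)"
    using N by (intro sum.mono_neutral_cong) (auto simp: out small S(1) not_le)
  also have "\<dots> = 0" using S(3) by (simp add: y_def)
  finally have "\<forall>p\<in>{-2..<int N}. y p = 0" using *[of y N] y by blast
  then have "y q = 0" using small N[OF S(4)] by (metis atLeastLessThan_iff not_le)
  then show ?thesis using S(4) by (simp add: y_def)
qed

lemma findim_tanaka: "findim (tanaka H p)"
proof (induction "nat (p + 1)" arbitrary: p rule: less_induct)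
  case less
  show ?case
  proof (cases "p < 0")
    case True then show ?thesis
      by (simp add: tanaka_neg findim_linear_image[OF findim_euclidean linear_adjoint_jet])
  next
    case False
    let ?b = "Basis :: (complex^'n) set"
    show ?thesis
    proof (rule findim_joint_kernel)
      show "finite ?b" "subspace (tanaka H p)" by (auto simp: subspace_tanaka)
      show "linear (shift (b, 0::real^'k))" for b :: "complex^'n" by (rule linear_shift)
      show "findim (shift (b, 0) ` tanaka H p)" for b
      proof (rule findim_subset[OF less[of "p - 1"]])
        show "nat (p - 1 + 1) < nat (p + 1)" using False by simp
        show "shift (b, 0) ` tanaka H p \<subseteq> tanaka H (p - 1)"
          using shift_m_deg[of _ p "(b, 0)" "-1"] by (auto simp: m_deg_def)
      qed
      show "P = 0" if P: "P \<in> tanaka H p" "\<And>b. b \<in> ?b \<Longrightarrow> shift (b, 0) P = 0" for P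
      proof (rule tanaka_transitive[OF P(1)])
        have lin: "linear (\<lambda>z. shift (z, 0) P)"
          using linear_compose[OF _ coinduced_linear_shift[OF tanaka_coinduced[OF P(1)]], of "\<lambda>z. (z, 0)"]
          by (simp add: o_def linear_iff)
        show "shift (z, 0) P = 0" for z
          using linear_eq_0_on_span[OF lin, of ?b z] P(2) by (simp only: span_Basis UNIV_I simp_thms)
      qed (use False in simp)
    qed
  qed
qed

end

section \<open>Embedding an arbitrary transitive prolongation\<close>

lemma component_total: "x \<in> G p \<Longrightarrow> x \<in> total_space G"
  unfolding total_space_def by (rule span_base) blast

locale prolongation = fundamental_form H
  for H :: "complex^'n::finite \<Rightarrow> complex^'n \<Rightarrow> complex^'k::finite" +
  fixes G :: "int \<Rightarrow> 'a::real_vector set" and br :: "'a \<Rightarrow> 'a \<Rightarrow> 'a"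
    and \<iota> :: "('n, 'k) nonpos \<Rightarrow> 'a"
  assumes prolongation: "transitive_prolongation H G br \<iota>"
begin

lemma graded_G: "graded_lie_algebra G br"
  and embedding_\<iota>: "graded_lie_embedding (nonpos_deg H) (nonpos_bracket H) G br \<iota>"
  and image_\<iota>: "p \<le> 0 \<Longrightarrow> \<iota> ` nonpos_deg H p = G p"
  and transitive_G: "p \<ge> 0 \<Longrightarrow> x \<in> G p \<Longrightarrow> x \<noteq> 0 \<Longrightarrow> \<exists>y\<in>G (-1). br x y \<noteq> 0"
  using prolongation unfolding transitive_prolongation_def by blast+

lemma lie_G: "real_lie_algebra (total_space G) br"
  and sub_G: "subspace (G p)"
  and graded: "x \<in> G p \<Longrightarrow> y \<in> G q \<Longrightarrow> br x y \<in> G (p + q)"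
  using graded_G by (auto simp: graded_lie_algebra_def)

lemma bilinear_br: "bilinear br"
  using real_lie_algebra.bilinear[OF lie_G] .

lemma linear_br_right: "linear (br x)" and linear_br_left: "linear (\<lambda>x. br x y)"
  using bilinear_br by (auto simp: bilinear_def)

lemma linear_\<iota>: "linear \<iota>"
  using embedding_\<iota> by (simp add: graded_lie_embedding_def)

lemma br_total: "x \<in> total_space G \<Longrightarrow> y \<in> total_space G \<Longrightarrow> br x y \<in> total_space G"
  using real_lie_algebra.closed[OF lie_G] .

lemma br_antisym:
  assumes x: "x \<in> total_space G" and y: "y \<in> total_space G"
  shows "br x y = - br y x"
proof -
  have "x + y \<in> total_space G" using x y unfolding total_space_def by (rule span_add)
  then have "br (x + y) (x + y) = 0" "br x x = 0" "br y y = 0"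
    using x y real_lie_algebra.alternating[OF lie_G] by auto
  then have "br x y + br y x = 0"
    by (simp add: linear_add[OF linear_br_right] linear_add[OF linear_br_left] add.commute)
  then show ?thesis by (rule eq_neg_iff_add_eq_0[THEN iffD2])
qed

lemma br_derivation:
  assumes x: "x \<in> total_space G" and y: "y \<in> total_space G" and z: "z \<in> total_space G"
  shows "br (br x y) z = br (br x z) y + br x (br y z)"
proof -
  have "br x (br y z) + br y (br z x) + br z (br x y) = 0"
    using real_lie_algebra.Jacobi[OF lie_G x y z] .
  moreover have "br z (br x y) = - br (br x y) z" using br_antisym br_total assms by blast
  moreover have "br y (br z x) = br (br x z) y"
    using br_antisym[OF z x] br_antisym[OF y br_total[OF x z]] by (simp add: linear_neg[OF linear_br_right])
  ultimately have "br x (br y z) + br (br x z) y - br (br x y) z = 0" by simp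
  then show ?thesis by (simp only: right_minus_eq add.commute)
qed

definition neg :: "('n, 'k) neg \<Rightarrow> 'a" where "neg v = \<iota> (v, 0)"

lemma linear_neg_incl: "linear neg"
  using linear_compose[OF _ linear_\<iota>, of "\<lambda>v. (v, 0)"] by (simp add: neg_def[abs_def] o_def linear_iff)

lemma nonpos_total: "D \<in> m_zero H \<Longrightarrow> (v, D) \<in> total_space (nonpos_deg H)"
proof -
  assume D: "D \<in> m_zero H"
  have "((fst v, 0), 0) \<in> nonpos_deg H (-1)" "((0, snd v), 0) \<in> nonpos_deg H (-2)" "(0, D) \<in> nonpos_deg H 0"
    using D by (auto simp: nonpos_deg_def m_deg_def)
  note this[THEN component_total[where G = "nonpos_deg H"]]
  moreover have "(v, D) = ((fst v, 0), 0) + ((0, snd v), 0) + (0, D)"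
    by (simp add: prod_eq_iff)
  ultimately show ?thesis unfolding total_space_def using span_add by metis
qed

lemma zero_m_zero: "0 \<in> m_zero H"
  using subspace_0[OF subspace_m_zero] .

lemma \<iota>_bracket:
  assumes "D \<in> m_zero H" "E \<in> m_zero H"
  shows "br (\<iota> (u, D)) (\<iota> (v, E)) = \<iota> (nonpos_bracket H (u, D) (v, E))"
proof -
  have "\<forall>x\<in>total_space (nonpos_deg H). \<forall>y\<in>total_space (nonpos_deg H). \<iota> (nonpos_bracket H x y) = br (\<iota> x) (\<iota> y)"
    using embedding_\<iota> by (simp add: graded_lie_embedding_def)
  then show ?thesis using nonpos_total assms by metis
qed

text \<open>
  The two instances of the embedding \<open>\<iota>\<close> that are needed: it identifies \<open>\<mm>\<^sub>-\<close> with a subalgebra, and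
  \<open>\<mm>\<^sub>0\<close> acts on this subalgebra by derivations.
\<close>

lemma neg_bracket: "br (neg u) (neg v) = neg (B u v)"
  unfolding neg_def \<iota>_bracket[OF zero_m_zero zero_m_zero] by (simp add: nonpos_bracket_def)

lemma \<iota>_zero_bracket: "D \<in> m_zero H \<Longrightarrow> br (\<iota> (0, D)) (neg v) = neg (blinfun_apply D v)"
  unfolding neg_def \<iota>_bracket[OF _ zero_m_zero] by (simp add: nonpos_bracket_def linear_0[OF linear_left])

lemma neg_eq_0: "neg v = 0 \<Longrightarrow> v = 0"
proof -
  assume "neg v = 0"
  then have "\<iota> (v, 0) = \<iota> (0, 0)" using linear_0[OF linear_\<iota>] by (simp add: neg_def zero_prod_def)
  moreover have "inj_on \<iota> (total_space (nonpos_deg H))"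
    using embedding_\<iota> by (simp add: graded_lie_embedding_def)
  ultimately show ?thesis using nonpos_total[OF zero_m_zero] by (metis Pair_inject inj_onD)
qed

lemma G_neg:
  assumes "p < 0" shows "G p = neg ` m_deg p"
proof -
  have "nonpos_deg H p = (\<lambda>v. (v, 0)) ` m_deg p" using assms by (auto simp: nonpos_deg_def)
  then show ?thesis using image_\<iota>[of p] assms by (simp add: neg_def[abs_def] image_image)
qed

lemma G_0: "G 0 = (\<lambda>D. \<iota> (0, D)) ` m_zero H"
proof -
  have "nonpos_deg H 0 = Pair 0 ` m_zero H" by (auto simp: nonpos_deg_def)
  then show ?thesis using image_\<iota>[of 0] by (simp add: image_image)
qed

lemma neg_in_G: "v \<in> m_deg p \<Longrightarrow> p < 0 \<Longrightarrow> neg v \<in> G p"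
  by (simp add: G_neg)

lemma neg_total: "neg v \<in> total_space G"
proof -
  have "neg v = neg (fst v, 0) + neg (0, snd v)"
    by (simp flip: linear_add[OF linear_neg_incl])
  moreover have "neg (fst v, 0) \<in> total_space G" "neg (0, snd v) \<in> total_space G"
    using neg_in_G[of "(fst v, 0)" "-1"] neg_in_G[of "(0, snd v)" "-2"]
    by (auto simp: m_deg_def intro: component_total)
  ultimately show ?thesis unfolding total_space_def using span_add by metis
qed

definition nonneg :: "'a set" where
  "nonneg = span (\<Union>p\<in>{0..}. G p)"

lemma nonneg_bracket: "x \<in> nonneg \<Longrightarrow> y \<in> nonneg \<Longrightarrow> br x y \<in> nonneg"
  unfolding nonneg_def
proof (rule bilinear_span[OF bilinear_br subspace_span])
  fix x y assume "x \<in> (\<Union>p\<in>{0..}. G p)" "y \<in> (\<Union>p\<in>{0..}. G p)"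
  then obtain p q where "p \<ge> 0" "x \<in> G p" "q \<ge> 0" "y \<in> G q" by auto
  then have "p + q \<ge> 0" "br x y \<in> G (p + q)" using graded by auto
  then show "br x y \<in> span (\<Union>p\<in>{0..}. G p)" by (intro span_base UN_I[of "p + q"]) auto
qed

lemma neg_nonneg:
  assumes "neg v + q = 0" "q \<in> nonneg"
  shows "v = 0"
proof -
  obtain S x where S: "finite S" "S \<subseteq> {0..}" "\<And>p. x p \<in> G p" "q = (\<Sum>p\<in>S. x p)"
    by (rule span_UN_decompose[OF sub_G assms(2)[unfolded nonneg_def]]) (rule that; assumption)
  define y where "y p = (if p = -1 then neg (fst v, 0) else if p = -2 then neg (0, snd v) else x p)" for p
  have "(\<Sum>p\<in>{-1, -2} \<union> S. y p) = (\<Sum>p\<in>{-1, -2}. y p) + (\<Sum>p\<in>S. y p)"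
    using S(1,2) by (intro sum.union_disjoint) auto
  also have "(\<Sum>p\<in>S. y p) = q"
    unfolding S(4) using S(2) by (intro sum.cong) (auto simp: y_def)
  also have "(\<Sum>p\<in>{-1, -2}. y p) = neg v"
    by (simp add: y_def flip: linear_add[OF linear_neg_incl])
  finally have sum: "(\<Sum>p\<in>{-1, -2} \<union> S. y p) = 0" using assms(1) by simp
  have mem: "y p \<in> G p" for p
    using S(3)[of p] neg_in_G[of "(fst v, 0)" "-1"] neg_in_G[of "(0, snd v)" "-2"]
    by (auto simp: y_def m_deg_def)
  have "y r = 0" if "r \<in> {-1, -2} \<union> S" for r
    using graded_lie_algebra.direct_sum[OF graded_G _ mem sum that] S(1) by simp
  from this[of "-1"] this[of "-2"] have "neg (fst v, 0) = 0" "neg (0, snd v) = 0"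
    by (auto simp: y_def)
  then show ?thesis using neg_eq_0 by (metis prod.collapse prod.inject zero_prod_def)
qed

lemma linear_neg_plus: "linear (\<lambda>(v, q). neg v + q)"
  using linear_compose_add[OF linear_compose[OF linear_fst linear_neg_incl] linear_snd]
  by (simp add: o_def case_prod_beta')

lemma total_decompose:
  assumes "x \<in> total_space G"
  obtains v q where "q \<in> nonneg" "x = neg v + q"
proof -
  let ?V = "{neg v + q | v q. q \<in> nonneg}"
  have V: "?V = (\<lambda>(v, q). neg v + q) ` (UNIV \<times> nonneg)" by auto
  have sub: "subspace ?V"
    unfolding V
    by (intro linear_subspace_image linear_neg_plus subspace_Times subspace_UNIV) (simp add: nonneg_def)
  have "G p \<subseteq> ?V" for p
  proof (cases "p < 0")
    case True
    then show ?thesis using G_neg span_zero unfolding nonneg_def by force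
  next
    case False
    then have "G p \<subseteq> nonneg"
      unfolding nonneg_def by (intro subset_trans[OF _ span_superset] UN_upper) simp
    moreover have "x = neg 0 + x" for x by (simp add: linear_0[OF linear_neg_incl])
    ultimately show ?thesis by blast
  qed
  then have "total_space G \<subseteq> ?V"
    unfolding total_space_def by (intro span_minimal[OF _ sub] UN_least)
  then show ?thesis using assms that by blast
qed

lemma ex_projection:
  "\<exists>\<pi>. linear \<pi> \<and> (\<forall>v. \<pi> (neg v) = v) \<and> (\<forall>q\<in>nonneg. \<pi> q = 0)"
proof -
  let ?s = "\<lambda>(v, q). neg v + q"
  note lin = linear_neg_plus
  have sub: "subspace (UNIV \<times> nonneg)"
    unfolding nonneg_def by (intro subspace_Times subspace_UNIV subspace_span)
  have "v = 0 \<and> q = 0" if "neg v + q = 0" "q \<in> nonneg" for v q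
    using neg_nonneg[OF that] that(1) linear_0[OF linear_neg_incl] by simp
  then have "inj_on ?s (UNIV \<times> nonneg)"
    unfolding linear_inj_on_iff_eq_0[OF lin sub] by (simp add: zero_prod_def split_paired_all)
  then obtain g where g: "linear g" "\<forall>v\<in>UNIV \<times> nonneg. g (?s v) = v"
    using linear_exists_left_inverse_on[OF lin sub] by blast
  have "linear (fst \<circ> g)" using linear_compose[OF g(1) linear_fst] .
  moreover have "(fst \<circ> g) (neg v) = v" for v
    using bspec[OF g(2), of "(v, 0)"] by (simp add: nonneg_def span_zero)
  moreover have "(fst \<circ> g) q = 0" if "q \<in> nonneg" for q
    using bspec[OF g(2), of "(0, q)"] that linear_0[OF linear_neg_incl] by auto
  ultimately show ?thesis by blast
qed

definition proj :: "'a \<Rightarrow> ('n, 'k) neg" where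
  "proj = (SOME \<pi>. linear \<pi> \<and> (\<forall>v. \<pi> (neg v) = v) \<and> (\<forall>q\<in>nonneg. \<pi> q = 0))"

lemma linear_proj: "linear proj" and proj_neg: "proj (neg v) = v"
  and proj_nonneg: "q \<in> nonneg \<Longrightarrow> proj q = 0"
  using someI_ex[OF ex_projection] unfolding proj_def by blast+

definition jet :: "'a \<Rightarrow> ('n, 'k) neg jet" where
  "jet x w = proj (foldl (\<lambda>u y. br u (neg y)) x w)"

lemma jet_Nil: "jet x [] = proj x"
  by (simp add: jet_def)

lemma shift_jet: "shift y (jet x) = jet (br x (neg y))"
  by (simp add: fun_eq_iff shift_apply jet_def)

lemma linear_foldl: "linear (\<lambda>x. foldl (\<lambda>u y. br u (neg y)) x w)"
proof (induction w)
  case (Cons y w)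
  then show ?case using linear_compose[OF linear_br_left[of "neg y"] Cons] by (simp add: o_def)
qed (simp add: linear_id[unfolded id_def])

lemma linear_jet: "linear jet"
  unfolding linear_fun_iff jet_def using linear_compose[OF linear_foldl linear_proj] by (simp add: o_def)

lemma foldl_total: "x \<in> total_space G \<Longrightarrow> foldl (\<lambda>u y. br u (neg y)) x w \<in> total_space G"
  by (induction w arbitrary: x) (auto simp: br_total neg_total)

lemma coinduced_jet:
  assumes x: "x \<in> total_space G"
  shows "coinduced B (jet x)"
  unfolding coinduced_def
proof (intro conjI allI)
  fix a b :: "('n, 'k) neg list"
  let ?u = "foldl (\<lambda>u y. br u (neg y)) x a"
  have u: "?u \<in> total_space G" using foldl_total x .
  have "linear (\<lambda>y. jet (br ?u (neg y)) b)"
    using linear_compose[OF linear_compose[OF linear_neg_incl linear_br_right[of ?u]]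
        linear_jet[unfolded linear_fun_iff, rule_format, of b]]
    by (simp add: o_def)
  then show "linear (\<lambda>y. jet x (a @ y # b))" by (simp add: jet_def)
  fix y y' :: "('n, 'k) neg"
  have "br (br ?u (neg y)) (neg y') = br (br ?u (neg y')) (neg y) + br ?u (neg (B y y'))"
    using br_derivation[OF u neg_total neg_total, of y y'] unfolding neg_bracket .
  then have "jet (br (br ?u (neg y)) (neg y')) b = jet (br (br ?u (neg y')) (neg y)) b + jet (br ?u (neg (B y y'))) b"
    by (simp only: linear_add[OF linear_jet] plus_fun_apply)
  then show "jet x (a @ y # y' # b) - jet x (a @ y' # y # b) = jet x (a @ B y y' # b)"
    by (simp add: jet_def)
qed

lemma jet_neg: "jet (neg v) = adjoint_jet B v"
proof
  show "jet (neg v) w = adjoint_jet B v w" for w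
    by (induction w arbitrary: v) (simp_all add: jet_def adjoint_jet_def proj_neg neg_bracket)
qed

lemma jet_\<iota>_zero:
  assumes D: "D \<in> m_zero H"
  shows "jet (\<iota> (0, D)) = derivation_jet B (blinfun_apply D)"
proof
  fix w
  have "\<iota> (0, D) \<in> nonneg"
    unfolding nonneg_def using D by (intro span_base UN_I[of 0]) (auto simp: G_0)
  then have "jet (\<iota> (0, D)) [] = 0" by (simp add: jet_Nil proj_nonneg)
  moreover have "jet (\<iota> (0, D)) (y # w') = adjoint_jet B (blinfun_apply D y) w'" for y w'
    using \<iota>_zero_bracket[OF D] fun_cong[OF jet_neg, of _ w'] by (simp add: jet_def)
  ultimately show "jet (\<iota> (0, D)) w = derivation_jet B (blinfun_apply D) w"
    by (cases w) (simp_all add: derivation_jet_def cons_jet_def)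
qed

text \<open>
  On the empty word this is the computation that motivates the bracket of jets; it uses that
  \<open>nonneg\<close> is a subalgebra. The inductive step is the Jacobi identity of \<open>br\<close>.
\<close>

lemma jet_bracket_jet:
  assumes "x \<in> total_space G" "y \<in> total_space G"
  shows "jet (br x y) = jet_bracket B (jet x) (jet y)"
proof
  show "jet (br x y) w = jet_bracket B (jet x) (jet y) w" for w
    using assms
  proof (induction w arbitrary: x y)
    case Nil
    obtain u q where x: "q \<in> nonneg" "x = neg u + q" using total_decompose[OF Nil(1)] .
    obtain v r where y: "r \<in> nonneg" "y = neg v + r" using total_decompose[OF Nil(2)] .
    have [simp]: "proj x = u" "proj y = v"
      by (simp_all add: x y linear_add[OF linear_proj] proj_neg proj_nonneg)
    have "br x y = br x (neg v) + br x r"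
      unfolding y(2) by (rule linear_add[OF linear_br_right])
    also have "br x r = br (neg u) r + br q r"
      unfolding x(2) by (rule linear_add[OF linear_br_left])
    also have "br (neg u) r = br (neg u) y - br (neg u) (neg v)"
      unfolding y(2) linear_add[OF linear_br_right] by simp
    also have "br (neg u) y = - br y (neg u)"
      by (rule br_antisym[OF neg_total Nil(2)])
    finally have "proj (br x y) = proj (br x (neg v)) - proj (br y (neg u)) - B u v"
      using proj_nonneg[OF nonneg_bracket[OF x(1) y(1)]]
      by (simp add: linear_add[OF linear_proj] linear_diff[OF linear_proj] linear_neg[OF linear_proj]
          neg_bracket proj_neg)
    then show ?case by (simp add: jet_def)
  next
    case (Cons z w)
    have "jet (br x y) (z # w) = jet (br (br x y) (neg z)) w" by (simp add: jet_def)
    also have "br (br x y) (neg z) = br (br x (neg z)) y + br x (br y (neg z))"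
      by (rule br_derivation[OF Cons.prems neg_total])
    also have "jet \<dots> w = jet (br (br x (neg z)) y) w + jet (br x (br y (neg z))) w"
      by (simp only: linear_add[OF linear_jet] plus_fun_apply)
    also have "\<dots> = jet_bracket B (jet x) (jet y) (z # w)"
      using Cons.IH[OF br_total[OF Cons.prems(1) neg_total] Cons.prems(2)]
        Cons.IH[OF Cons.prems(1) br_total[OF Cons.prems(2) neg_total]]
      by (simp only: jet_bracket.simps shift_jet)
    finally show ?case .
  qed
qed

lemma jet_image: "jet ` G p \<subseteq> tanaka H p"
proof (induction "nat p" arbitrary: p rule: less_induct)
  case less
  consider "p < 0" | "p = 0" | "p > 0" by linarith
  then show ?case
  proof cases
    case 1 then show ?thesis by (auto simp: G_neg tanaka_neg jet_neg)
  next
    case 2 then show ?thesis by (auto simp: G_0 tanaka_0 jet_\<iota>_zero)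
  next
    case 3
    have "jet x \<in> tanaka H p" if x: "x \<in> G p" for x
      unfolding tanaka_pos[OF 3] shift_jet
    proof (intro conjI allI)
      show "coinduced B (jet x)" using coinduced_jet[OF component_total[where G = G, OF x]] .
      have "x \<in> nonneg" unfolding nonneg_def using x 3 by (intro span_base UN_I[of p]) auto
      then show "jet x [] = 0" by (simp add: jet_Nil proj_nonneg)
      have br: "br x (neg v) \<in> G (p + d)" if "v \<in> m_deg d" "d < 0" for v d
        using graded[OF x neg_in_G[OF that]] .
      show "jet (br x (neg (z, 0))) \<in> tanaka H (p - 1)" for z
        using less[of "p - 1"] br[of "(z, 0)" "-1"] 3 by (auto simp: m_deg_def)
      show "jet (br x (neg (0, t))) \<in> tanaka H (p - 2)" for t
        using less[of "p - 2"] br[of "(0, t)" "-2"] 3 by (auto simp: m_deg_def)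
    qed
    then show ?thesis by blast
  qed
qed

lemma jet_image_nonpos:
  assumes "p \<le> 0" shows "jet ` G p = tanaka H p"
proof (cases "p = 0")
  case True
  show ?thesis unfolding True G_0 tanaka_0 image_image by (rule image_cong[OF refl jet_\<iota>_zero])
next
  case False
  then have "p < 0" using assms by simp
  then show ?thesis by (simp add: G_neg tanaka_neg image_image jet_neg)
qed

text \<open>
  Induction on the degree: if \<open>jet x = 0\<close>, then the jets of all brackets of \<open>x\<close> with \<open>\<mm>\<^sub>-\<^sub>1\<close> vanish as
  well, hence so do the brackets, and then \<open>x = 0\<close> by transitivity.
\<close>

lemma jet_eq_0_component:
  assumes "x \<in> G p" "jet x = 0"
  shows "x = 0"
  using assms
proof (induction "nat (p + 1)" arbitrary: p x rule: less_induct)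
  case less
  show ?case
  proof (cases "p < 0")
    case True
    then obtain v where v: "x = neg v" using less.prems(1) unfolding G_neg[OF True] by blast
    have "v = 0" using fun_cong[OF less.prems(2), of "[]"] unfolding v jet_neg by simp
    then show ?thesis using v linear_0[OF linear_neg_incl] by simp
  next
    case False
    have "br x y = 0" if y: "y \<in> G (-1)" for y
    proof (rule less.hyps)
      show "nat (p + -1 + 1) < nat (p + 1)" using False by simp
      show "br x y \<in> G (p + -1)" using graded[OF less.prems(1) y] .
      obtain v where "y = neg v" using y G_neg[of "-1"] by auto
      then show "jet (br x y) = 0" using shift_jet[of v x] unfolding less.prems(2) shift_zero by simp
    qed
    then show ?thesis using transitive_G[of p x] less.prems(1) False by fastforce
  qed
qed

lemma inj_on_jet: "inj_on jet (total_space G)"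
  unfolding linear_inj_on_iff_eq_0[OF linear_jet subspace_span[of "\<Union>p. G p", folded total_space_def]]
proof (intro ballI impI)
  fix x assume x: "x \<in> total_space G" "jet x = 0"
  obtain S y where S: "finite S" "\<And>p. y p \<in> G p" "x = (\<Sum>p\<in>S. y p)"
    by (rule span_UN_decompose[OF sub_G x(1)[unfolded total_space_def]]) (rule that; assumption)
  have "(\<Sum>p\<in>S. jet (y p)) = 0"
    using x(2) unfolding S(3) linear_sum[OF linear_jet] .
  then have "jet (y p) = 0" if "p \<in> S" for p
    using tanaka_direct_sum[OF S(1) _ _ that, of "\<lambda>p. jet (y p)"] subsetD[OF jet_image imageI[OF S(2)]]
    by (simp only:)
  then show "x = 0" unfolding S(3) using jet_eq_0_component[OF S(2)] by (intro sum.neutral) blast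
qed

end

section \<open>Maximality\<close>

context fundamental_form
begin

lemma tanaka_total: "P \<in> tanaka H p \<Longrightarrow> P \<in> total_space (tanaka H)"
  by (rule component_total[where G = "tanaka H"])

lemma coinduced_total:
  assumes "P \<in> total_space (tanaka H)" shows "coinduced B P"
proof -
  have "total_space (tanaka H) \<subseteq> {P. coinduced B P}"
    unfolding total_space_def by (rule span_minimal[OF _ subspace_coinduced]) (auto intro: tanaka_coinduced)
  then show ?thesis using assms by blast
qed

lemma jet_bracket_total:
  assumes P: "P \<in> total_space (tanaka H)" and Q: "Q \<in> total_space (tanaka H)"
  shows "jet_bracket B P Q \<in> total_space (tanaka H)"
proof -
  let ?T = "total_space (tanaka H)"
  have T: "subspace ?T" unfolding total_space_def by (rule subspace_span)
  have 1: "jet_bracket B P' Q \<in> ?T" if P': "P' \<in> (\<Union>p. tanaka H p)" for P'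
  proof -
    have "?T \<subseteq> jet_bracket B P' -` ?T"
    proof (subst (1) total_space_def, rule span_minimal)
      show "(\<Union>q. tanaka H q) \<subseteq> jet_bracket B P' -` ?T"
        using P' by (auto intro!: tanaka_total[OF tanaka_bracket])
      show "subspace (jet_bracket B P' -` ?T)"
        using P' by (auto intro!: linear_subspace_vimage jet_bracket_linear_right T tanaka_coinduced)
    qed
    then show ?thesis using Q by blast
  qed
  have "?T \<subseteq> (\<lambda>P. jet_bracket B P Q) -` ?T"
  proof (subst (1) total_space_def, rule span_minimal)
    show "(\<Union>p. tanaka H p) \<subseteq> (\<lambda>P. jet_bracket B P Q) -` ?T" using 1 by blast
    show "subspace ((\<lambda>P. jet_bracket B P Q) -` ?T)"
      by (intro linear_subspace_vimage jet_bracket_linear_left coinduced_total Q T)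
  qed
  then show ?thesis using P by blast
qed

lemma countable_total: "\<exists>C. countable C \<and> total_space (tanaka H) = span C"
proof -
  have "\<exists>F. finite F \<and> F \<subseteq> tanaka H p \<and> tanaka H p \<subseteq> span F" for p
    using findim_basis[OF findim_tanaka] by metis
  then obtain F where F: "\<And>p. finite (F p)" "\<And>p. F p \<subseteq> tanaka H p" "\<And>p. tanaka H p \<subseteq> span (F p)"
    by metis
  have "(\<Union>p. F p) \<subseteq> (\<Union>p. tanaka H p)" using F(2) by blast
  moreover have "(\<Union>p. tanaka H p) \<subseteq> span (\<Union>p. F p)"
    using F(3) span_mono[of "F _" "\<Union>p. F p"] by blast
  ultimately have "total_space (tanaka H) = span (\<Union>p. F p)"
    unfolding total_space_def by (intro equalityI span_minimal[OF _ subspace_span] span_mono)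
  moreover have "countable (\<Union>p. F p)"
    using F(1) by (auto intro: countable_finite)
  ultimately show ?thesis by blast
qed

end

context prolongation
begin

text \<open>
  Transport of the universal prolongation along an injective linear map \<open>h\<close>, with left inverse \<open>k\<close>,
  into the type over which maximality quantifies. Since \<open>k\<close> takes values in the universal
  prolongation only, the transported bracket is bilinear on the whole ambient space, whereas the
  bracket of arbitrary functions on words is not.
\<close>

context
  fixes h :: "('n, 'k) neg jet \<Rightarrow> (nat, real) poly_mapping" and k
  assumes linear_h: "linear h" and inj_h: "inj_on h (total_space (tanaka H))"
    and linear_k: "linear k" and range_k: "range k \<subseteq> total_space (tanaka H)"
    and k_h: "\<And>P. P \<in> total_space (tanaka H) \<Longrightarrow> k (h P) = P"
begin

definition model :: "int \<Rightarrow> (nat, real) poly_mapping set" where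
  "model p = h ` tanaka H p"

definition model_bracket :: "(nat, real) poly_mapping \<Rightarrow> (nat, real) poly_mapping \<Rightarrow> (nat, real) poly_mapping" where
  "model_bracket u v = h (jet_bracket B (k u) (k v))"

lemma k_total: "k u \<in> total_space (tanaka H)"
  using range_k by blast

lemma total_model: "total_space model = h ` total_space (tanaka H)"
  unfolding total_space_def model_def linear_span_image[OF linear_h, symmetric] by (simp add: image_UN)

lemma model_bracket_h:
  assumes "P \<in> total_space (tanaka H)" "Q \<in> total_space (tanaka H)"
  shows "model_bracket (h P) (h Q) = h (jet_bracket B P Q)"
  by (simp only: model_bracket_def k_h assms)

lemma h_eq_0: "P \<in> total_space (tanaka H) \<Longrightarrow> h P = 0 \<Longrightarrow> P = 0"
  using k_h[of P] linear_0[OF linear_k] by simp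

lemma graded_model: "graded_lie_algebra model model_bracket"
proof (rule graded_lie_algebra.intro)
  show "real_lie_algebra (total_space model) model_bracket"
  proof
    show "subspace (total_space model)" unfolding total_space_def by (rule subspace_span)
    show "bilinear model_bracket"
      unfolding bilinear_def model_bracket_def
      using linear_compose[OF linear_compose[OF linear_k jet_bracket_linear_right[OF coinduced_total[OF k_total]]] linear_h]
        linear_compose[OF linear_compose[OF linear_k jet_bracket_linear_left[OF coinduced_total[OF k_total]]] linear_h]
      by (simp add: o_def)
    show "model_bracket u v \<in> total_space model" for u v
      unfolding total_model model_bracket_def by (intro imageI jet_bracket_total k_total)
    show "model_bracket u u = 0" for u
    proof -
      have "jet_bracket B P P w = 0" for P w
        using jet_bracket_antisym[of P P w] by (simp add: eq_neg_iff_add_eq_0 flip: scaleR_2)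
      then have "jet_bracket B (k u) (k u) = 0" by (simp add: fun_eq_iff)
      then show ?thesis unfolding model_bracket_def by (simp only: linear_0[OF linear_h])
    qed
    fix x y z assume "x \<in> total_space model" "y \<in> total_space model" "z \<in> total_space model"
    then obtain P Q R where xyz: "x = h P" "y = h Q" "z = h R"
      and T: "P \<in> total_space (tanaka H)" "Q \<in> total_space (tanaka H)" "R \<in> total_space (tanaka H)"
      unfolding total_model by blast
    have "h (jet_bracket B P (jet_bracket B Q R)) + h (jet_bracket B Q (jet_bracket B R P))
        + h (jet_bracket B R (jet_bracket B P Q)) = h 0"
      unfolding jet_bracket_Jacobi[OF T[THEN coinduced_total], symmetric] linear_add[OF linear_h] ..
    then show "model_bracket x (model_bracket y z) + model_bracket y (model_bracket z x)
        + model_bracket z (model_bracket x y) = 0"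
      unfolding xyz by (simp only: model_bracket_h T jet_bracket_total linear_0[OF linear_h])
  qed
  show "subspace (model p)" for p
    unfolding model_def by (rule linear_subspace_image[OF linear_h subspace_tanaka])
  show "x q = 0" if S: "finite S" "\<And>p. p \<in> S \<Longrightarrow> x p \<in> model p" "(\<Sum>p\<in>S. x p) = 0" "q \<in> S" for S x q
  proof -
    have x: "k (x p) \<in> tanaka H p" "h (k (x p)) = x p" if "p \<in> S" for p
      using S(2)[OF that] k_h[OF tanaka_total] unfolding model_def by auto
    have sum: "(\<Sum>p\<in>S. k (x p)) = 0"
      unfolding linear_sum[OF linear_k, symmetric] S(3) by (rule linear_0[OF linear_k])
    have "k (x q) = 0"
      by (rule tanaka_direct_sum[OF S(1) _ sum S(4)]) (rule x(1))
    then show ?thesis using x(2)[OF S(4)] linear_0[OF linear_h] by simp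
  qed
  show "model_bracket x y \<in> model (p + q)" if xy: "x \<in> model p" "y \<in> model q" for x y p q
  proof -
    obtain P Q where PQ: "x = h P" "P \<in> tanaka H p" "y = h Q" "Q \<in> tanaka H q"
      using xy unfolding model_def by blast
    show ?thesis
      unfolding PQ(1,3) model_bracket_h[OF PQ(2,4)[THEN tanaka_total]] model_def
      by (intro imageI tanaka_bracket PQ)
  qed
qed

lemma jet_total: "x \<in> total_space G \<Longrightarrow> jet x \<in> total_space (tanaka H)"
proof -
  assume x: "x \<in> total_space G"
  have "jet ` total_space G = span (\<Union>p. jet ` G p)"
    unfolding total_space_def linear_span_image[OF linear_jet, symmetric] image_UN ..
  also have "\<dots> \<subseteq> total_space (tanaka H)"
    unfolding total_space_def by (intro span_mono UN_mono jet_image subset_refl)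
  finally show ?thesis using x by blast
qed

lemma embedding_model: "graded_lie_embedding G br model model_bracket (h \<circ> jet)"
  unfolding graded_lie_embedding_def
proof (intro conjI allI ballI)
  show "linear (h \<circ> jet)" by (rule linear_compose[OF linear_jet linear_h])
  show "inj_on (h \<circ> jet) (total_space G)"
    by (rule comp_inj_on[OF inj_on_jet inj_on_subset[OF inj_h]]) (auto intro: jet_total)
  show "(h \<circ> jet) ` G p \<subseteq> model p" for p
    using jet_image[of p] by (auto simp: model_def)
  show "(h \<circ> jet) (br x y) = model_bracket ((h \<circ> jet) x) ((h \<circ> jet) y)"
    if "x \<in> total_space G" "y \<in> total_space G" for x y
    unfolding o_def by (simp only: model_bracket_h jet_total jet_bracket_jet that)
qed

lemma \<iota>_total:
  assumes "u \<in> total_space (nonpos_deg H)" shows "\<iota> u \<in> total_space G"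
proof -
  have "\<iota> ` nonpos_deg H p \<subseteq> G p" for p
    using embedding_\<iota> by (simp add: graded_lie_embedding_def)
  then have "\<iota> ` total_space (nonpos_deg H) \<subseteq> total_space G"
    unfolding total_space_def linear_span_image[OF linear_\<iota>, symmetric] image_UN
    by (intro span_mono UN_mono subset_refl)
  then show ?thesis using assms by blast
qed

lemma prolongation_model: "transitive_prolongation H model model_bracket (h \<circ> jet \<circ> \<iota>)"
  unfolding transitive_prolongation_def
proof (intro conjI allI impI ballI)
  show "graded_lie_algebra model model_bracket" by (rule graded_model)
  note e1 = embedding_\<iota>[unfolded graded_lie_embedding_def]
  note e2 = embedding_model[unfolded graded_lie_embedding_def]
  show "graded_lie_embedding (nonpos_deg H) (nonpos_bracket H) model model_bracket (h \<circ> jet \<circ> \<iota>)"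
    unfolding graded_lie_embedding_def
  proof (intro conjI allI ballI)
    show "linear (h \<circ> jet \<circ> \<iota>)" by (rule linear_compose[OF linear_\<iota>]) (use e2 in blast)
    show "inj_on (h \<circ> jet \<circ> \<iota>) (total_space (nonpos_deg H))"
      by (rule comp_inj_on[of \<iota> _ "h \<circ> jet"]) (use e1 e2 in \<open>auto intro: inj_on_subset \<iota>_total\<close>)
    show "(h \<circ> jet \<circ> \<iota>) ` nonpos_deg H p \<subseteq> model p" for p
      using e1 e2 by (force simp: image_subset_iff)
    show "(h \<circ> jet \<circ> \<iota>) (nonpos_bracket H x y) = model_bracket ((h \<circ> jet \<circ> \<iota>) x) ((h \<circ> jet \<circ> \<iota>) y)"
      if "x \<in> total_space (nonpos_deg H)" "y \<in> total_space (nonpos_deg H)" for x y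
      using e1 e2 that \<iota>_total by (simp only: o_apply)
  qed
  show "(h \<circ> jet \<circ> \<iota>) ` nonpos_deg H p = model p" if "p \<le> 0" for p
    by (simp only: image_comp[symmetric] image_\<iota>[OF that] jet_image_nonpos[OF that] model_def)
  show "\<exists>y\<in>model (-1). model_bracket x y \<noteq> 0" if p: "0 \<le> p" "x \<in> model p" "x \<noteq> 0" for p x
  proof -
    obtain P where P: "x = h P" "P \<in> tanaka H p" using p(2) unfolding model_def by blast
    have "P \<noteq> 0" using p(3) linear_0[OF linear_h] unfolding P(1) by metis
    then obtain z where z: "shift (z, 0) P \<noteq> 0" using tanaka_transitive[OF P(2) p(1)] by blast
    have a: "adjoint_jet B (z, 0) \<in> tanaka H (-1)" by (simp add: tanaka_neg m_deg_def)
    have "shift (z, 0) P \<in> tanaka H (p + -1)" by (rule shift_m_deg[OF P(2)]) (simp add: m_deg_def)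
    then have "h (shift (z, 0) P) \<noteq> 0" using z h_eq_0 tanaka_total by blast
    moreover have "model_bracket x (h (adjoint_jet B (z, 0))) = h (shift (z, 0) P)"
      unfolding P(1) model_bracket_h[OF tanaka_total[OF P(2)] tanaka_total[OF a]]
        jet_bracket_adjoint_jet[OF tanaka_coinduced[OF P(2)]] ..
    ultimately show ?thesis using a unfolding model_def by (intro bexI[of _ "h (adjoint_jet B (z, 0))"]) auto
  qed
qed

lemma jet_onto_if_model:
  assumes "(h \<circ> jet) ` G p = model p"
  shows "jet ` G p = tanaka H p"
proof -
  have "h ` jet ` G p = h ` tanaka H p" using assms by (simp only: model_def image_comp)
  moreover have "jet ` G p \<subseteq> total_space (tanaka H)" "tanaka H p \<subseteq> total_space (tanaka H)"
    using jet_image[of p] tanaka_total by blast+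
  ultimately show ?thesis using inj_on_image_eq_iff[OF inj_h] by blast
qed

end

lemma maximal_imp_jet_onto:
  assumes "levi_tanaka_algebra H G br \<iota>"
  shows "jet ` G p = tanaka H p"
proof -
  let ?T = "total_space (tanaka H)"
  obtain C where C: "countable C" "?T = span C" using countable_total by blast
  obtain h :: "('n, 'k) neg jet \<Rightarrow> (nat, real) poly_mapping" where h: "linear h" "inj_on h ?T"
    using countable_span_embedding[OF C(1)] unfolding C(2) by metis
  have T: "subspace ?T" unfolding total_space_def by (rule subspace_span)
  obtain k where k: "range k \<subseteq> ?T" "linear k" "\<forall>P\<in>?T. k (h P) = P"
    using linear_exists_left_inverse_on[OF h(1) T h(2)] by blast
  note k' = bspec[OF k(3)]
  have "(h \<circ> jet) ` G p = model h p"
    using assms prolongation_model[OF h k(2,1) k'] embedding_model[OF h k(2,1) k']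
    unfolding levi_tanaka_algebra_def by blast
  then show ?thesis by (rule jet_onto_if_model[OF h k(2,1), rotated]) (rule k')
qed

lemma dim_levi_tanaka:
  assumes "levi_tanaka_algebra H G br \<iota>"
  shows "dim (G p) = dim (tanaka H p)"
proof -
  have "span (G p) = G p" using sub_G by (rule span_eq_iff[THEN iffD2])
  then have "inj_on jet (span (G p))"
    using inj_on_subset[OF inj_on_jet] component_total[where G = G] by (metis subsetI)
  then show ?thesis
    using dim_inj_on_image[OF linear_jet, of "G p"] maximal_imp_jet_onto[OF assms] by simp
qed

end

text \<open>
  The Levi-Tanaka algebra of any fundamental form is the universal prolongation: by maximality,
  \<open>jet\<close> maps each of its components onto that of \<open>tanaka\<close>.
\<close>

theorem levi_tanaka_dim:
  assumes "levi_tanaka_algebra H G br \<iota>"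
  shows "dim (G p) = dim (tanaka H p)"
proof -
  interpret prolongation H G br \<iota>
    using assms unfolding levi_tanaka_algebra_def by unfold_locales blast+
  show ?thesis by (rule dim_levi_tanaka[OF assms])
qed

section \<open>A square-zero extension of the complex numbers\<close>

text \<open>
  The ring \<open>A = \<complex>[e0, e1, e2] / (ei ej)\<close>, with coefficients of \<open>1, e0, e1, e2\<close>. The two kinds of
  coordinates of \<open>\<mm>\<^sub>-\<^sub>1\<close> become elements of \<open>A\<close>, and all identities below are identities of
  commutative rings.
\<close>

datatype sqz = Sqz (res: complex) (nil0: complex) (nil1: complex) (nil2: complex)

instantiation sqz :: comm_ring_1
begin

definition "0 = Sqz 0 0 0 0"
definition "1 = Sqz 1 0 0 0"
definition "s + t = Sqz (res s + res t) (nil0 s + nil0 t) (nil1 s + nil1 t) (nil2 s + nil2 t)"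
definition "- s = Sqz (- res s) (- nil0 s) (- nil1 s) (- nil2 s)"
definition "s - t = Sqz (res s - res t) (nil0 s - nil0 t) (nil1 s - nil1 t) (nil2 s - nil2 t)"
definition "s * t = Sqz (res s * res t) (res s * nil0 t + nil0 s * res t)
  (res s * nil1 t + nil1 s * res t) (res s * nil2 t + nil2 s * res t)"

instance
  by standard
    (simp_all add: zero_sqz_def one_sqz_def plus_sqz_def uminus_sqz_def minus_sqz_def times_sqz_def algebra_simps)

end

instantiation sqz :: real_algebra_1
begin

definition "r *\<^sub>R s = Sqz (r *\<^sub>R res s) (r *\<^sub>R nil0 s) (r *\<^sub>R nil1 s) (r *\<^sub>R nil2 s)"

instance
  by standard
    (simp_all add: scaleR_sqz_def plus_sqz_def times_sqz_def algebra_simps)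

end

lemmas sqz_defs = zero_sqz_def one_sqz_def plus_sqz_def uminus_sqz_def minus_sqz_def times_sqz_def scaleR_sqz_def

text \<open>
  The subring \<open>R\<close>, in which the conjugate coordinates take their values.
\<close>

definition no_nil0 :: "sqz set" where
  "no_nil0 = {r. nil0 r = 0}"

definition imag :: sqz where "imag = Sqz \<i> 0 0 0"

lemma no_nil0_closed:
  "0 \<in> no_nil0" "1 \<in> no_nil0" "imag \<in> no_nil0"
  "r \<in> no_nil0 \<Longrightarrow> - r \<in> no_nil0" "r \<in> no_nil0 \<Longrightarrow> a *\<^sub>R r \<in> no_nil0"
  "r \<in> no_nil0 \<Longrightarrow> s \<in> no_nil0 \<Longrightarrow> r + s \<in> no_nil0"
  "r \<in> no_nil0 \<Longrightarrow> s \<in> no_nil0 \<Longrightarrow> r - s \<in> no_nil0"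
  "r \<in> no_nil0 \<Longrightarrow> s \<in> no_nil0 \<Longrightarrow> r * s \<in> no_nil0"
  by (simp_all add: no_nil0_def imag_def sqz_defs)

definition xpart :: "complex^7 \<Rightarrow> sqz" where
  "xpart z = Sqz (z$1) (z$3) (z$4) (z$6)"

definition ypart :: "complex^7 \<Rightarrow> sqz" where
  "ypart z = Sqz (cnj (z$2)) 0 (cnj (z$5)) (cnj (z$7))"

text \<open>
  Real and imaginary parts are interchanged because \<open>Im (\<i> r) = Re r\<close>: the components of \<open>H_M\<close>
  belonging to a coefficient \<open>\<alpha> = 1\<close> and \<open>\<alpha> = \<i>\<close> have imaginary parts \<open>Im r\<close> and \<open>Re r\<close>, with
  \<open>r = z1 cnj z2' - z1' cnj z2\<close> for the first of the four pairs.
\<close>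

definition tpart :: "real^8 \<Rightarrow> sqz" where
  "tpart t = Sqz (Complex (t$2) (t$1)) (Complex (t$4) (t$3)) (Complex (t$6) (t$5)) (Complex (t$8) (t$7))"

definition of_xy :: "sqz \<Rightarrow> sqz \<Rightarrow> complex^7" where
  "of_xy x y = vector [res x, cnj (res y), nil0 x, nil1 x, cnj (nil1 y), nil2 x, cnj (nil2 y)]"

definition of_t :: "sqz \<Rightarrow> real^8" where
  "of_t s = vector [Im (res s), Re (res s), Im (nil0 s), Re (nil0 s), Im (nil1 s), Re (nil1 s), Im (nil2 s), Re (nil2 s)]"

lemma forall_7: "(\<forall>i::7. P i) \<longleftrightarrow> P 1 \<and> P 2 \<and> P 3 \<and> P 4 \<and> P 5 \<and> P 6 \<and> P 7"
  using exhaust_7 by metis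

lemma xpart_of_xy [simp]: "xpart (of_xy x y) = x"
  by (simp add: xpart_def of_xy_def vector_7)

lemma ypart_of_xy [simp]: "y \<in> no_nil0 \<Longrightarrow> ypart (of_xy x y) = y"
  by (cases y) (simp add: ypart_def of_xy_def vector_7 no_nil0_def)

lemma tpart_of_t [simp]: "tpart (of_t s) = s"
  by (cases s) (simp add: tpart_def of_t_def vector_8 Complex_eq complex_eq_iff)

lemma ypart_no_nil0 [simp]: "ypart z \<in> no_nil0"
  by (simp add: ypart_def no_nil0_def)

lemma neg_eqI:
  assumes "xpart (fst v) = xpart (fst w)" "ypart (fst v) = ypart (fst w)" "tpart (snd v) = tpart (snd w)"
  shows "v = w"
  using assms by (simp add: prod_eq_iff vec_eq_iff forall_7 forall_8 xpart_def ypart_def tpart_def)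

lemma linear_xpart: "linear xpart" and linear_ypart: "linear ypart" and linear_tpart: "linear tpart"
  by (auto intro!: linearI simp: xpart_def ypart_def tpart_def sqz_defs complex_eq_iff)

lemmas linear_parts =
  linear_0[OF linear_xpart] linear_0[OF linear_ypart] linear_0[OF linear_tpart]
  linear_add[OF linear_xpart] linear_add[OF linear_ypart] linear_add[OF linear_tpart]
  linear_diff[OF linear_xpart] linear_diff[OF linear_ypart] linear_diff[OF linear_tpart]
  linear_scale[OF linear_xpart] linear_scale[OF linear_ypart] linear_scale[OF linear_tpart]

lemma xpart_i: "xpart (\<i> *s z) = imag * xpart z" and ypart_i: "ypart (\<i> *s z) = - imag * ypart z"
  by (simp_all add: xpart_def ypart_def imag_def sqz_defs)

lemma tpart_bracket: "tpart (Im_vec (H_M z z')) = xpart z * ypart z' - xpart z' * ypart z"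
  by (simp add: tpart_def Im_vec_def H_M_component xpart_def ypart_def sqz_defs complex_eq_iff)

interpretation H_M: fundamental_form H_M
  by unfold_locales (rule hermitian_form_H_M, rule fundamental_H_M)

lemma m_bracket_parts:
  "xpart (fst (m_bracket H_M v w)) = 0" "ypart (fst (m_bracket H_M v w)) = 0"
  "tpart (snd (m_bracket H_M v w)) = xpart (fst v) * ypart (fst w) - xpart (fst w) * ypart (fst v)"
  by (simp_all add: m_bracket_def linear_parts tpart_bracket)

section \<open>Derivations in ring coordinates\<close>

definition block_op :: "(sqz \<Rightarrow> sqz) \<Rightarrow> (sqz \<Rightarrow> sqz) \<Rightarrow> (sqz \<Rightarrow> sqz) \<Rightarrow> (7, 8) neg \<Rightarrow> (7, 8) neg" where
  "block_op P Q U v = (of_xy (P (xpart (fst v))) (Q (ypart (fst v))), of_t (U (tpart (snd v))))"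

lemma block_op_parts:
  "xpart (fst (block_op P Q U v)) = P (xpart (fst v))"
  "Q (ypart (fst v)) \<in> no_nil0 \<Longrightarrow> ypart (fst (block_op P Q U v)) = Q (ypart (fst v))"
  "tpart (snd (block_op P Q U v)) = U (tpart (snd v))"
  by (simp_all add: block_op_def)

text \<open>
  Such an operator respects the grading, and commutes with \<open>J\<close> since \<open>J\<close> is multiplication by \<open>imag\<close>
  on \<open>xpart\<close> and by \<open>- imag\<close> on \<open>ypart\<close>; the condition on \<open>U\<close> is the derivation property for the
  bracket \<open>x y' - x' y\<close>.
\<close>

lemma derivation_jet_block_op:
  assumes lin: "linear P" "linear Q" "linear U"
    and Q: "\<And>y. y \<in> no_nil0 \<Longrightarrow> Q y \<in> no_nil0"
    and deriv: "\<And>x y. y \<in> no_nil0 \<Longrightarrow> U (x * y) = P x * y + x * Q y"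
    and I: "\<And>x. P (imag * x) = imag * P x" "\<And>y. y \<in> no_nil0 \<Longrightarrow> Q (imag * y) = imag * Q y"
  shows "derivation_jet (m_bracket H_M) (block_op P Q U) \<in> tanaka H_M 0"
proof -
  let ?D = "block_op P Q U"
  note parts = block_op_parts(1,3) block_op_parts(2)[where Q = Q, OF Q[OF ypart_no_nil0]]
  note l = linear_0[OF lin(1)] linear_0[OF lin(2)] linear_0[OF lin(3)]
    linear_add[OF lin(1)] linear_add[OF lin(2)] linear_add[OF lin(3)] linear_diff[OF lin(3)]
    linear_scale[OF lin(1)] linear_scale[OF lin(2)] linear_scale[OF lin(3)] linear_neg[OF lin(2)]
  have "linear ?D"
    by (rule linearI; rule neg_eqI) (simp_all add: parts linear_parts l)
  then have D: "blinfun_apply (Blinfun ?D) = ?D"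
    by (simp add: bounded_linear_Blinfun_apply linear_conv_bounded_linear)
  have "Blinfun ?D \<in> m_zero H_M"
  proof (rule H_M.m_zeroI; unfold D)
    show "?D (m_bracket H_M v w) = m_bracket H_M (?D v) w + m_bracket H_M v (?D w)" for v w
      by (rule neg_eqI) (simp_all add: parts m_bracket_parts linear_parts l deriv algebra_simps)
    show "?D v \<in> m_deg p" if "v \<in> m_deg p" for v p
    proof -
      have "?D (z, 0) = (fst (?D (z, 0)), 0)" "?D (0, t) = (0, snd (?D (0, t)))" "?D 0 = 0" for z t
        by (rule neg_eqI, simp_all add: parts linear_parts l)+
      then show ?thesis using that by (fastforce simp: m_deg_def split: if_splits)
    qed
    show "fst (?D (\<i> *s z, 0)) = \<i> *s fst (?D (z, 0))" for z
    proof -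
      have "(fst (?D (\<i> *s z, 0)), 0::real^8) = (\<i> *s fst (?D (z, 0)), 0)"
        by (rule neg_eqI) (simp_all add: parts xpart_i ypart_i I l)
      then show ?thesis by simp
    qed
  qed
  then show ?thesis unfolding tanaka_0 using D by force
qed

section \<open>Degrees one and two\<close>

definition R_linear :: "(sqz \<Rightarrow> sqz) \<Rightarrow> bool" where
  "R_linear \<phi> \<longleftrightarrow> (\<forall>s t. \<phi> (s + t) = \<phi> s + \<phi> t) \<and> (\<forall>s. \<forall>r\<in>no_nil0. \<phi> (s * r) = \<phi> s * r) \<and>
     (\<forall>s. \<phi> s \<in> no_nil0)"

lemma
  assumes "R_linear \<phi>"
  shows R_linear_add: "\<phi> (s + t) = \<phi> s + \<phi> t"
    and R_linear_mult: "r \<in> no_nil0 \<Longrightarrow> \<phi> (s * r) = \<phi> s * r"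
    and R_linear_no_nil0: "\<phi> s \<in> no_nil0"
    and R_linear_linear: "linear \<phi>"
    and R_linear_imag: "\<phi> (imag * s) = imag * \<phi> s"
proof -
  show a: "\<phi> (s + t) = \<phi> s + \<phi> t" and m: "r \<in> no_nil0 \<Longrightarrow> \<phi> (s * r) = \<phi> s * r" and "\<phi> s \<in> no_nil0" for s t r
    using assms by (auto simp: R_linear_def)
  have "\<phi> (c *\<^sub>R s) = c *\<^sub>R \<phi> s" for c s
    using m[OF no_nil0_closed(5)[OF no_nil0_closed(2)], of s c] by simp
  then show "linear \<phi>" using a by (intro linearI)
  show "\<phi> (imag * s) = imag * \<phi> s"
    using m[OF no_nil0_closed(3), of s] by (simp add: mult.commute)
qed

lemma R_linear_times:
  assumes "R_linear \<phi>" "r \<in> no_nil0" shows "R_linear (\<lambda>s. r * \<phi> s)"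
  unfolding R_linear_def
proof (intro conjI allI ballI)
  show "r * \<phi> (s + t) = r * \<phi> s + r * \<phi> t" for s t
    by (simp only: R_linear_add[OF assms(1)] distrib_left)
  show "r * \<phi> (s * t) = r * \<phi> s * t" if "t \<in> no_nil0" for s t
    by (simp only: R_linear_mult[OF assms(1) that] mult.assoc)
  show "r * \<phi> s \<in> no_nil0" for s
    by (intro no_nil0_closed assms R_linear_no_nil0)
qed

text \<open>
  The element of degree 1 given by \<open>c\<close> and \<open>\<phi>\<close> sends \<open>t\<close> in degree -2 to the vector
  \<open>deg1_vec c \<phi> t\<close> with coordinates \<open>(c t, \<phi> t)\<close>, and \<open>z\<close> in degree -1 to the derivation
  \<open>deg1_op c \<phi> z\<close>. In this form the coefficients \<open>-1\<close> and \<open>2\<close> are forced: \<open>deg1_op z z' - deg1_op z' z\<close> has to be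
  \<open>deg1_vec [z, z']\<close>, the action on \<open>t\<close> has to be \<open>[deg1_vec t, z]\<close>, and each \<open>deg1_op z\<close> has to be a
  derivation.
\<close>

definition deg1_op :: "sqz \<Rightarrow> (sqz \<Rightarrow> sqz) \<Rightarrow> complex^7 \<Rightarrow> (7, 8) neg \<Rightarrow> (7, 8) neg" where
  "deg1_op c \<phi> z = block_op
     (\<lambda>x. - (c * ypart z * x) - xpart z * \<phi> x - x * \<phi> (xpart z))
     (\<lambda>y. 2 * c * ypart z * y + \<phi> (xpart z) * y)
     (\<lambda>t. c * t * ypart z - xpart z * \<phi> t)"

definition deg1_vec :: "sqz \<Rightarrow> (sqz \<Rightarrow> sqz) \<Rightarrow> real^8 \<Rightarrow> (7, 8) neg" where
  "deg1_vec c \<phi> t = (of_xy (c * tpart t) (\<phi> (tpart t)), 0)"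

definition jet1 :: "sqz \<Rightarrow> (sqz \<Rightarrow> sqz) \<Rightarrow> (7, 8) neg jet" where
  "jet1 c \<phi> = cons_jet (\<lambda>v. derivation_jet (m_bracket H_M) (deg1_op c \<phi> (fst v)) +
     adjoint_jet (m_bracket H_M) (deg1_vec c \<phi> (snd v)))"

text \<open>
  The element of degree 2 given by \<open>\<phi>\<close> sends \<open>t\<close> to the derivation \<open>deg2_op \<phi> t\<close>, and \<open>z\<close> to the element
  of degree 1 with parameters \<open>\<phi> x\<close> and \<open>y \<phi>\<close>; its value \<open>(\<phi>(x) t, y \<phi>(t))\<close> at \<open>t\<close> has to agree
  with \<open>deg2_op \<phi> t z\<close>.
\<close>

definition deg2_op :: "(sqz \<Rightarrow> sqz) \<Rightarrow> real^8 \<Rightarrow> (7, 8) neg \<Rightarrow> (7, 8) neg" where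
  "deg2_op \<phi> t = block_op (\<lambda>x. \<phi> x * tpart t) (\<lambda>y. \<phi> (tpart t) * y) (\<lambda>s. \<phi> s * tpart t + \<phi> (tpart t) * s)"

definition jet2 :: "(sqz \<Rightarrow> sqz) \<Rightarrow> (7, 8) neg jet" where
  "jet2 \<phi> = cons_jet (\<lambda>v. jet1 (\<phi> (xpart (fst v))) (\<lambda>s. ypart (fst v) * \<phi> s) +
     derivation_jet (m_bracket H_M) (deg2_op \<phi> (snd v)))"

lemma numeral_no_nil0: "2 * r \<in> no_nil0" if "r \<in> no_nil0"
  using no_nil0_closed(6)[OF that that] by (simp only: mult_2)

context
  fixes \<phi> :: "sqz \<Rightarrow> sqz"
  assumes \<phi>: "R_linear \<phi>"
begin

lemma R_linear_mult': "r \<in> no_nil0 \<Longrightarrow> \<phi> (r * s) = r * \<phi> s"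
  using R_linear_mult[OF \<phi>, of r s] by (simp only: mult.commute)

lemmas phi_simps =
  linear_0[OF R_linear_linear[OF \<phi>]] linear_add[OF R_linear_linear[OF \<phi>]]
  linear_diff[OF R_linear_linear[OF \<phi>]] linear_scale[OF R_linear_linear[OF \<phi>]]
  R_linear_mult[OF \<phi> ypart_no_nil0] R_linear_no_nil0[OF \<phi>] R_linear_mult'[OF ypart_no_nil0]

lemma deg1_op_parts:
  assumes "c \<in> no_nil0"
  shows "xpart (fst (deg1_op c \<phi> z v)) = - (c * ypart z * xpart (fst v)) - xpart z * \<phi> (xpart (fst v)) - xpart (fst v) * \<phi> (xpart z)"
    "ypart (fst (deg1_op c \<phi> z v)) = 2 * c * ypart z * ypart (fst v) + \<phi> (xpart z) * ypart (fst v)"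
    "tpart (snd (deg1_op c \<phi> z v)) = c * tpart (snd v) * ypart z - xpart z * \<phi> (tpart (snd v))"
  unfolding deg1_op_def using assms
  by (simp_all add: block_op_parts no_nil0_closed numeral_no_nil0 phi_simps)

lemma deg2_op_parts:
  "xpart (fst (deg2_op \<phi> t v)) = \<phi> (xpart (fst v)) * tpart t"
  "ypart (fst (deg2_op \<phi> t v)) = \<phi> (tpart t) * ypart (fst v)"
  "tpart (snd (deg2_op \<phi> t v)) = \<phi> (tpart (snd v)) * tpart t + \<phi> (tpart t) * tpart (snd v)"
  unfolding deg2_op_def by (simp_all add: block_op_parts no_nil0_closed phi_simps)

lemma derivation_jet_deg1_op:
  assumes c: "c \<in> no_nil0"
  shows "derivation_jet (m_bracket H_M) (deg1_op c \<phi> z) \<in> tanaka H_M 0"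
  unfolding deg1_op_def
proof (rule derivation_jet_block_op)
  note s = R_linear_mult[OF \<phi>] R_linear_imag[OF \<phi>] phi_simps c
  show "linear (\<lambda>x. - (c * ypart z * x) - xpart z * \<phi> x - x * \<phi> (xpart z))"
    "linear (\<lambda>y. 2 * c * ypart z * y + \<phi> (xpart z) * y)" "linear (\<lambda>t. c * t * ypart z - xpart z * \<phi> t)"
    by (auto intro!: linearI simp: s algebra_simps)
  show "2 * c * ypart z * y + \<phi> (xpart z) * y \<in> no_nil0" if "y \<in> no_nil0" for y
    using that c by (intro no_nil0_closed numeral_no_nil0 ypart_no_nil0 phi_simps(6))
  show "c * (x * y) * ypart z - xpart z * \<phi> (x * y) =
      (- (c * ypart z * x) - xpart z * \<phi> x - x * \<phi> (xpart z)) * y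
      + x * (2 * c * ypart z * y + \<phi> (xpart z) * y)" if "y \<in> no_nil0" for x y
    unfolding R_linear_mult[OF \<phi> that] by (simp add: algebra_simps)
  show "- (c * ypart z * (imag * x)) - xpart z * \<phi> (imag * x) - imag * x * \<phi> (xpart z) =
      imag * (- (c * ypart z * x) - xpart z * \<phi> x - x * \<phi> (xpart z))" for x
    unfolding R_linear_imag[OF \<phi>] by (simp add: algebra_simps)
  show "2 * c * ypart z * (imag * y) + \<phi> (xpart z) * (imag * y) =
      imag * (2 * c * ypart z * y + \<phi> (xpart z) * y)" for y
    by (simp only: distrib_left ac_simps)
qed

lemma derivation_jet_deg2_op: "derivation_jet (m_bracket H_M) (deg2_op \<phi> t) \<in> tanaka H_M 0"
  unfolding deg2_op_def
proof (rule derivation_jet_block_op)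
  show "linear (\<lambda>x. \<phi> x * tpart t)" "linear (\<lambda>y. \<phi> (tpart t) * y)"
    "linear (\<lambda>s. \<phi> s * tpart t + \<phi> (tpart t) * s)"
    by (auto intro!: linearI simp: phi_simps algebra_simps)
  show "\<phi> (tpart t) * y \<in> no_nil0" if "y \<in> no_nil0" for y
    using that by (intro no_nil0_closed phi_simps(6))
  show "\<phi> (x * y) * tpart t + \<phi> (tpart t) * (x * y) = \<phi> x * tpart t * y + x * (\<phi> (tpart t) * y)"
    if "y \<in> no_nil0" for x y
    unfolding R_linear_mult[OF \<phi> that] by (simp add: algebra_simps)
  show "\<phi> (imag * x) * tpart t = imag * (\<phi> x * tpart t)" for x
    unfolding R_linear_imag[OF \<phi>] by (simp add: algebra_simps)
  show "\<phi> (tpart t) * (imag * y) = imag * (\<phi> (tpart t) * y)" for y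
    by (simp only: ac_simps)
qed

end

abbreviation "B \<equiv> m_bracket H_M"

lemma adjoint_jet_in_tanaka: "adjoint_jet B (z, 0) \<in> tanaka H_M (-1)"
  by (simp add: H_M.tanaka_neg m_deg_def)

context
  fixes \<phi> :: "sqz \<Rightarrow> sqz" and c :: sqz
  assumes \<phi>: "R_linear \<phi>" and c: "c \<in> no_nil0"
begin

lemma deg1_vec_parts:
  "xpart (fst (deg1_vec c \<phi> t)) = c * tpart t" "ypart (fst (deg1_vec c \<phi> t)) = \<phi> (tpart t)"
  "tpart (snd (deg1_vec c \<phi> t)) = 0"
  by (simp_all add: deg1_vec_def phi_simps[OF \<phi>] linear_parts)

lemmas parts1 = deg1_op_parts[OF \<phi> c] deg1_vec_parts phi_simps(1-5,7)[OF \<phi>] linear_parts m_bracket_parts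

lemma deg1_op_zero: "deg1_op c \<phi> 0 = (\<lambda>u. 0)"
  by (rule ext, rule neg_eqI) (simp_all add: parts1)

lemma deg1_op_add: "deg1_op c \<phi> (z + z') = (\<lambda>u. deg1_op c \<phi> z u + deg1_op c \<phi> z' u)"
  by (rule ext, rule neg_eqI) (simp_all add: parts1 algebra_simps)

lemma deg1_op_scaleR: "deg1_op c \<phi> (r *\<^sub>R z) = (\<lambda>u. r *\<^sub>R deg1_op c \<phi> z u)"
  by (rule ext, rule neg_eqI) (simp_all add: parts1 scaleR_diff_right scaleR_add_right)

lemma deg1_vec_zero: "deg1_vec c \<phi> 0 = 0"
  by (rule neg_eqI) (simp_all add: parts1)

lemma linear_deg1_vec: "linear (deg1_vec c \<phi>)"
  by (rule linearI; rule neg_eqI) (simp_all add: parts1 distrib_left)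

text \<open>
  The cocycle condition of the degree 1 element; for the \<open>t\<close>-coordinate it says that the derivation
  acts on \<open>t\<close> by \<open>[deg1_vec t, z]\<close>.
\<close>

lemma deg1_op_swap:
  "deg1_op c \<phi> (fst v) v' + B (deg1_vec c \<phi> (snd v)) v' - (deg1_op c \<phi> (fst v') v + B (deg1_vec c \<phi> (snd v')) v)
     = deg1_vec c \<phi> (snd (B v v'))"
  by (rule neg_eqI) (simp_all add: parts1 algebra_simps)

lemma derivation_jet_deg1_op_zero: "derivation_jet B (deg1_op c \<phi> 0) = 0"
  by (simp only: deg1_op_zero H_M.derivation_jet_zero)

lemma adjoint_jet_deg1_vec_zero: "adjoint_jet B (deg1_vec c \<phi> 0) = 0"
  by (simp only: deg1_vec_zero linear_0[OF H_M.linear_adjoint_jet])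

lemma adjoint_jet_deg1_vec: "adjoint_jet B (deg1_vec c \<phi> t) \<in> tanaka H_M (-1)"
  unfolding deg1_vec_def by (rule adjoint_jet_in_tanaka)

lemma shift_jet1:
  "shift (z, 0) (jet1 c \<phi>) = derivation_jet B (deg1_op c \<phi> z)"
  "shift (0, t) (jet1 c \<phi>) = adjoint_jet B (deg1_vec c \<phi> t)"
  by (simp_all only: jet1_def shift_cons_jet fst_conv snd_conv derivation_jet_deg1_op_zero adjoint_jet_deg1_vec_zero
      add_0_left add_0_right)

lemma coinduced_jet1: "coinduced B (jet1 c \<phi>)"
  unfolding jet1_def
proof (rule coinduced_cons_jet)
  have "linear (\<lambda>z. derivation_jet B (deg1_op c \<phi> z))"
    by (rule linearI)
      (simp_all only: deg1_op_add deg1_op_scaleR H_M.derivation_jet_add H_M.derivation_jet_scaleR)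
  from linear_compose[OF linear_fst this]
    linear_compose[OF linear_snd linear_compose[OF linear_deg1_vec H_M.linear_adjoint_jet]]
  show "linear (\<lambda>v. derivation_jet B (deg1_op c \<phi> (fst v)) + adjoint_jet B (deg1_vec c \<phi> (snd v)))"
    by (intro linear_compose_add) (simp_all only: o_def)
  show "shift v' (derivation_jet B (deg1_op c \<phi> (fst v)) + adjoint_jet B (deg1_vec c \<phi> (snd v))) -
      shift v (derivation_jet B (deg1_op c \<phi> (fst v')) + adjoint_jet B (deg1_vec c \<phi> (snd v'))) =
      derivation_jet B (deg1_op c \<phi> (fst (B v v'))) + adjoint_jet B (deg1_vec c \<phi> (snd (B v v')))" for v v'
  proof -
    have "fst (B v v') = 0" by (simp add: m_bracket_def)
    then show ?thesis
      by (simp only: shift_add shift_derivation_jet shift_adjoint_jet derivation_jet_deg1_op_zero add_0_left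
          linear_add[OF H_M.linear_adjoint_jet, symmetric] linear_diff[OF H_M.linear_adjoint_jet, symmetric]
          deg1_op_swap)
  qed
  show "coinduced B (derivation_jet B (deg1_op c \<phi> (fst v)) + adjoint_jet B (deg1_vec c \<phi> (snd v)))" for v
    using subspace_add[OF subspace_coinduced[of B]] H_M.tanaka_coinduced[OF derivation_jet_deg1_op[OF \<phi> c]]
      H_M.coinduced_adjoint_jet by blast
qed

lemma jet1_in_tanaka: "jet1 c \<phi> \<in> tanaka H_M 1"
proof -
  have "jet1 c \<phi> [] = 0" by (simp only: jet1_def cons_jet_Nil)
  moreover have "shift (z, 0) (jet1 c \<phi>) \<in> tanaka H_M (1 - 1)" for z
    unfolding shift_jet1 using derivation_jet_deg1_op[OF \<phi> c] by simp
  moreover have "shift (0, t) (jet1 c \<phi>) \<in> tanaka H_M (1 - 2)" for t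
    unfolding shift_jet1 using adjoint_jet_deg1_vec by simp
  ultimately show ?thesis
    using tanaka_pos[of 1 "jet1 c \<phi>" H_M] coinduced_jet1 by simp
qed

end

lemma jet1_add: "jet1 (c + c') (\<lambda>s. \<phi> s + \<phi>' s) = jet1 c \<phi> + jet1 c' \<phi>'"
  if "R_linear \<phi>" "R_linear \<phi>'" "c \<in> no_nil0" "c' \<in> no_nil0"
proof -
  have s: "R_linear (\<lambda>s. \<phi> s + \<phi>' s)"
    using that(1,2) by (simp add: R_linear_def distrib_right no_nil0_closed)
  have cc: "c + c' \<in> no_nil0" by (rule no_nil0_closed(6)[OF that(3,4)])
  have o: "deg1_op (c + c') (\<lambda>s. \<phi> s + \<phi>' s) z = (\<lambda>u. deg1_op c \<phi> z u + deg1_op c' \<phi>' z u)" for z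
    by (rule ext, rule neg_eqI)
      (simp_all add: deg1_op_parts[OF s cc] deg1_op_parts[OF that(1,3)] deg1_op_parts[OF that(2,4)] linear_parts algebra_simps)
  have d: "deg1_vec (c + c') (\<lambda>s. \<phi> s + \<phi>' s) t = deg1_vec c \<phi> t + deg1_vec c' \<phi>' t" for t
    by (rule neg_eqI)
      (simp_all add: deg1_vec_parts[OF s cc] deg1_vec_parts[OF that(1,3)] deg1_vec_parts[OF that(2,4)] linear_parts algebra_simps)
  show ?thesis
    by (simp only: jet1_def o d cons_jet_add[symmetric]
        H_M.derivation_jet_add linear_add[OF H_M.linear_adjoint_jet] ac_simps)
qed

lemma jet1_scaleR: "jet1 (r *\<^sub>R c) (\<lambda>s. r *\<^sub>R \<phi> s) = r *\<^sub>R jet1 c \<phi>"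
  if "R_linear \<phi>" "c \<in> no_nil0"
proof -
  have s: "R_linear (\<lambda>s. r *\<^sub>R \<phi> s)"
    using that(1) by (simp add: R_linear_def scaleR_add_right no_nil0_closed)
  have cc: "r *\<^sub>R c \<in> no_nil0" by (rule no_nil0_closed(5)[OF that(2)])
  have o: "deg1_op (r *\<^sub>R c) (\<lambda>s. r *\<^sub>R \<phi> s) z = (\<lambda>u. r *\<^sub>R deg1_op c \<phi> z u)" for z
    by (rule ext, rule neg_eqI)
      (simp_all add: deg1_op_parts[OF s cc] deg1_op_parts[OF that] linear_parts scaleR_diff_right scaleR_add_right)
  have d: "deg1_vec (r *\<^sub>R c) (\<lambda>s. r *\<^sub>R \<phi> s) t = r *\<^sub>R deg1_vec c \<phi> t" for t
    by (rule neg_eqI)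
      (simp_all add: deg1_vec_parts[OF s cc] deg1_vec_parts[OF that] linear_parts)
  show ?thesis
    by (simp only: jet1_def o d cons_jet_scaleR[symmetric]
        H_M.derivation_jet_scaleR linear_scale[OF H_M.linear_adjoint_jet] scaleR_add_right)
qed

context
  fixes \<phi> :: "sqz \<Rightarrow> sqz"
  assumes \<phi>: "R_linear \<phi>"
begin

lemmas parts2 = deg2_op_parts[OF \<phi>] phi_simps(1-5,7)[OF \<phi>] linear_parts m_bracket_parts

abbreviation (input) "c_of z \<equiv> \<phi> (xpart z)"
abbreviation (input) "phi_of z \<equiv> (\<lambda>s. ypart z * \<phi> s)"

lemma R_linear_phi_of: "R_linear (phi_of z)" and c_of_no_nil0: "c_of z \<in> no_nil0"
  by (rule R_linear_times[OF \<phi> ypart_no_nil0], rule R_linear_no_nil0[OF \<phi>])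

lemma deg2_op_zero: "deg2_op \<phi> 0 = (\<lambda>u. 0)"
  by (rule ext, rule neg_eqI) (simp_all add: parts2)

lemma deg2_op_add: "deg2_op \<phi> (t + t') = (\<lambda>u. deg2_op \<phi> t u + deg2_op \<phi> t' u)"
  by (rule ext, rule neg_eqI) (simp_all add: parts2 algebra_simps)

lemma deg2_op_scaleR: "deg2_op \<phi> (r *\<^sub>R t) = (\<lambda>u. r *\<^sub>R deg2_op \<phi> t u)"
  by (rule ext, rule neg_eqI) (simp_all add: parts2 scaleR_add_right)

lemma derivation_jet_deg2_op_zero: "derivation_jet B (deg2_op \<phi> 0) = 0"
  by (simp only: deg2_op_zero H_M.derivation_jet_zero)

text \<open>
  Together with the next lemma, the cocycle condition of the degree 2 element: this is its part with
  values in degree 0, for the bracket of two elements of degree -1.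
\<close>

lemma deg2_op_swap:
  "(\<lambda>u. deg1_op (c_of z) (phi_of z) z' u - deg1_op (c_of z') (phi_of z') z u) = deg2_op \<phi> (Im_vec (H_M z z'))"
  by (rule ext, rule neg_eqI)
    (simp_all add: deg1_op_parts[OF R_linear_phi_of c_of_no_nil0] parts2 tpart_bracket algebra_simps)

lemma deg2_vec_swap:
  "deg1_vec (c_of (fst v)) (phi_of (fst v)) (snd v') + deg2_op \<phi> (snd v) v' =
   deg1_vec (c_of (fst v')) (phi_of (fst v')) (snd v) + deg2_op \<phi> (snd v') v"
  by (rule neg_eqI; simp only: fst_add snd_add linear_parts deg1_vec_parts[OF R_linear_phi_of c_of_no_nil0] deg2_op_parts[OF \<phi>];
      simp add: algebra_simps)

lemma jet1_c_zero: "jet1 (c_of 0) (phi_of 0) = 0"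
proof -
  have "jet1 (0 *\<^sub>R 0) (\<lambda>s. 0 *\<^sub>R \<phi> s) = 0 *\<^sub>R jet1 0 \<phi>"
    by (rule jet1_scaleR[OF \<phi> no_nil0_closed(1)])
  then show ?thesis by (simp only: linear_parts phi_simps(1)[OF \<phi>] mult_zero_left scaleR_zero_left)
qed

lemma shift_jet2:
  "shift (z, 0) (jet2 \<phi>) = jet1 (c_of z) (phi_of z)"
  "shift (0, t) (jet2 \<phi>) = derivation_jet B (deg2_op \<phi> t)"
  by (simp_all only: jet2_def shift_cons_jet fst_conv snd_conv derivation_jet_deg2_op_zero jet1_c_zero
      add_0_left add_0_right)

lemma coinduced_jet2: "coinduced B (jet2 \<phi>)"
  unfolding jet2_def
proof (rule coinduced_cons_jet)
  have "linear (\<lambda>t. derivation_jet B (deg2_op \<phi> t))"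
    by (rule linearI)
      (simp_all only: deg2_op_add deg2_op_scaleR H_M.derivation_jet_add H_M.derivation_jet_scaleR)
  moreover have "linear (\<lambda>z. jet1 (c_of z) (phi_of z))"
    by (rule linearI)
      (simp_all only: linear_parts phi_simps[OF \<phi>] distrib_right mult_scaleR_left jet1_add[OF R_linear_phi_of R_linear_phi_of c_of_no_nil0 c_of_no_nil0]
        jet1_scaleR[OF R_linear_phi_of c_of_no_nil0])
  ultimately show "linear (\<lambda>v. jet1 (c_of (fst v)) (phi_of (fst v)) + derivation_jet B (deg2_op \<phi> (snd v)))"
    using linear_compose[OF linear_fst] linear_compose[OF linear_snd]
    by (intro linear_compose_add) (fastforce simp: o_def)+
  show "coinduced B (jet1 (c_of (fst v)) (phi_of (fst v)) + derivation_jet B (deg2_op \<phi> (snd v)))" for v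
    using subspace_add[OF subspace_coinduced[of B]] H_M.tanaka_coinduced[OF derivation_jet_deg2_op[OF \<phi>]]
      coinduced_jet1[OF R_linear_phi_of c_of_no_nil0] by blast
  show "shift v' (jet1 (c_of (fst v)) (phi_of (fst v)) + derivation_jet B (deg2_op \<phi> (snd v))) -
      shift v (jet1 (c_of (fst v')) (phi_of (fst v')) + derivation_jet B (deg2_op \<phi> (snd v'))) =
      jet1 (c_of (fst (B v v'))) (phi_of (fst (B v v'))) + derivation_jet B (deg2_op \<phi> (snd (B v v')))" for v v'
  proof -
    let ?D = "\<lambda>v v'. derivation_jet B (deg1_op (c_of (fst v)) (phi_of (fst v)) (fst v'))"
    let ?A = "\<lambda>v v'. adjoint_jet B (deg1_vec (c_of (fst v)) (phi_of (fst v)) (snd v') + deg2_op \<phi> (snd v) v')"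
    have F: "shift v' (jet1 (c_of (fst v)) (phi_of (fst v)) + derivation_jet B (deg2_op \<phi> (snd v))) = ?D v v' + ?A v v'" for v v'
      by (simp only: jet1_def shift_add shift_cons_jet shift_derivation_jet
          linear_add[OF H_M.linear_adjoint_jet] add.assoc)
    have A: "?A v v' = ?A v' v" by (simp only: deg2_vec_swap[of v v'])
    have "?D v v' = derivation_jet B (\<lambda>u. deg2_op \<phi> (snd (B v v')) u + deg1_op (c_of (fst v')) (phi_of (fst v')) (fst v) u)"
      unfolding m_bracket_def snd_conv deg2_op_swap[symmetric] by simp
    then have D: "?D v v' = derivation_jet B (deg2_op \<phi> (snd (B v v'))) + ?D v' v"
      by (simp only: H_M.derivation_jet_add)
    have "fst (B v v') = 0" by (simp add: m_bracket_def)
    then show ?thesis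
      unfolding F A D by (simp only: jet1_c_zero) simp
  qed
qed

lemma jet2_in_tanaka: "jet2 \<phi> \<in> tanaka H_M 2"
proof -
  have "jet2 \<phi> [] = 0" by (simp only: jet2_def cons_jet_Nil)
  moreover have "shift (z, 0) (jet2 \<phi>) \<in> tanaka H_M (2 - 1)" for z
    unfolding shift_jet2 using jet1_in_tanaka[OF R_linear_phi_of c_of_no_nil0] by simp
  moreover have "shift (0, t) (jet2 \<phi>) \<in> tanaka H_M (2 - 2)" for t
    unfolding shift_jet2 using derivation_jet_deg2_op[OF \<phi>] by simp
  ultimately show ?thesis
    using tanaka_pos[of 2 "jet2 \<phi>" H_M] coinduced_jet2 by simp
qed

end

section \<open>Counting dimensions\<close>

definition coeff :: "complex^3 \<Rightarrow> sqz" where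
  "coeff q = Sqz (q$1) 0 (q$2) (q$3)"

text \<open>
  A parametrization of the \<open>R\<close>-linear maps: the second summand is the part that kills \<open>R\<close> and maps
  \<open>e0\<close> into the span of \<open>e1, e2\<close>.
\<close>

definition R_linear_map :: "(complex^3) \<times> (complex^2) \<Rightarrow> sqz \<Rightarrow> sqz" where
  "R_linear_map p s = coeff (fst p) * Sqz (res s) 0 (nil1 s) (nil2 s)
     + Sqz 0 0 (snd p $ 1 * nil0 s) (snd p $ 2 * nil0 s)"

lemma R_linear_R_linear_map: "R_linear (R_linear_map p)"
  by (auto simp: R_linear_def R_linear_map_def coeff_def no_nil0_def sqz_defs algebra_simps)

lemma coeff_in: "coeff q \<in> no_nil0"
  by (simp add: coeff_def no_nil0_def)

lemma R_linear_map_linear: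
  "R_linear_map (p + p') = (\<lambda>s. R_linear_map p s + R_linear_map p' s)"
  "R_linear_map (r *\<^sub>R p) = (\<lambda>s. r *\<^sub>R R_linear_map p s)"
  by (auto simp: fun_eq_iff R_linear_map_def coeff_def sqz_defs algebra_simps)

lemma coeff_linear: "coeff (q + q') = coeff q + coeff q'" "coeff (r *\<^sub>R q) = r *\<^sub>R coeff q"
  by (auto simp: coeff_def sqz_defs)

lemma coeff_eq_0: "coeff q = 0 \<Longrightarrow> q = 0"
  by (simp add: coeff_def sqz_defs vec_eq_iff forall_3)

lemma R_linear_map_eq_0:
  assumes "R_linear_map p 1 = 0" "R_linear_map p (Sqz 0 1 0 0) = 0" shows "p = 0"
  using assms by (simp add: R_linear_map_def coeff_def sqz_defs prod_eq_iff vec_eq_iff forall_2 forall_3)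

text \<open>
  The parameters can be read off from the values on degree -2, since \<open>t\<close> runs through all of \<open>A\<close>.
\<close>

lemma dim_tanaka_1: "16 \<le> dim (tanaka H_M 1)"
proof -
  let ?f = "\<lambda>(q, p). jet1 (coeff q) (R_linear_map p)"
  have f: "linear ?f"
    by (rule linearI)
      (simp_all only: split_beta fst_add snd_add fst_scaleR snd_scaleR coeff_linear R_linear_map_linear
        jet1_add[OF R_linear_R_linear_map R_linear_R_linear_map coeff_in coeff_in]
        jet1_scaleR[OF R_linear_R_linear_map coeff_in])
  have "q = 0 \<and> p = 0" if "jet1 (coeff q) (R_linear_map p) = 0" for q p
  proof -
    have "deg1_vec (coeff q) (R_linear_map p) t = 0" for t
      using fun_cong[OF shift_jet1(2)[OF R_linear_R_linear_map[of p] coeff_in[of q], of t], of "[]"]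
      unfolding that shift_zero by simp
    then have "xpart (fst (deg1_vec (coeff q) (R_linear_map p) t)) = xpart 0"
      "ypart (fst (deg1_vec (coeff q) (R_linear_map p) t)) = ypart 0" for t
      by simp_all
    from this[of "of_t _", unfolded deg1_vec_parts[OF R_linear_R_linear_map coeff_in] tpart_of_t linear_parts]
    have "coeff q * s = 0" "R_linear_map p s = 0" for s .
    from this(1)[of 1] this(2) show ?thesis using coeff_eq_0 R_linear_map_eq_0 by simp
  qed
  then have "inj ?f"
    unfolding linear_injective_0[OF f] by (auto simp: zero_prod_def)
  moreover have "range ?f \<subseteq> tanaka H_M 1"
    using jet1_in_tanaka[OF R_linear_R_linear_map coeff_in] by auto
  ultimately show ?thesis
    using dim_inj_image_le[OF H_M.findim_tanaka f, of 1] by simp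
qed

lemma jet2_add: "jet2 (\<lambda>s. \<phi> s + \<phi>' s) = jet2 \<phi> + jet2 \<phi>'" if "R_linear \<phi>" "R_linear \<phi>'"
proof -
  have s: "R_linear (\<lambda>s. \<phi> s + \<phi>' s)"
    using that by (simp add: R_linear_def distrib_right no_nil0_closed)
  have o: "deg2_op (\<lambda>s. \<phi> s + \<phi>' s) t = (\<lambda>u. deg2_op \<phi> t u + deg2_op \<phi>' t u)" for t
    by (rule ext, rule neg_eqI)
      (simp_all add: deg2_op_parts[OF s] deg2_op_parts[OF that(1)] deg2_op_parts[OF that(2)] linear_parts algebra_simps)
  show ?thesis
    by (simp only: jet2_def o H_M.derivation_jet_add distrib_left cons_jet_add[symmetric]
        jet1_add[OF R_linear_phi_of[OF that(1)] R_linear_phi_of[OF that(2)] c_of_no_nil0[OF that(1)] c_of_no_nil0[OF that(2)]]) (simp only: ac_simps)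
qed

lemma jet2_scaleR: "jet2 (\<lambda>s. r *\<^sub>R \<phi> s) = r *\<^sub>R jet2 \<phi>" if "R_linear \<phi>"
proof -
  have s: "R_linear (\<lambda>s. r *\<^sub>R \<phi> s)"
    using that by (simp add: R_linear_def scaleR_add_right no_nil0_closed)
  have o: "deg2_op (\<lambda>s. r *\<^sub>R \<phi> s) t = (\<lambda>u. r *\<^sub>R deg2_op \<phi> t u)" for t
    by (rule ext, rule neg_eqI)
      (simp_all add: deg2_op_parts[OF s] deg2_op_parts[OF that] linear_parts scaleR_add_right)
  show ?thesis
    by (simp only: jet2_def o H_M.derivation_jet_scaleR mult_scaleR_right cons_jet_scaleR[symmetric]
        jet1_scaleR[OF R_linear_phi_of[OF that] c_of_no_nil0[OF that]] scaleR_add_right)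
qed

text \<open>
  \<open>\<phi>\<close> is recovered from the value \<open>\<phi>(x) t\<close> of the derivation at \<open>t = 1\<close>.
\<close>

lemma dim_tanaka_2: "10 \<le> dim (tanaka H_M 2)"
proof -
  let ?f = "\<lambda>p. jet2 (R_linear_map p)"
  have f: "linear ?f"
    by (rule linearI)
      (simp_all only: R_linear_map_linear jet2_add[OF R_linear_R_linear_map R_linear_R_linear_map]
        jet2_scaleR[OF R_linear_R_linear_map])
  have "p = 0" if "jet2 (R_linear_map p) = 0" for p
  proof -
    note \<phi> = R_linear_R_linear_map[of p]
    have "deg2_op (R_linear_map p) t v = 0" for t v
      using fun_cong[OF shift_jet2(2)[OF \<phi>, of t], of "[v]"]
      unfolding that shift_zero by (simp add: derivation_jet_def cons_jet_def)
    then have "xpart (fst (deg2_op (R_linear_map p) t v)) = xpart 0" for t v by simp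
    from this[of "of_t 1" "(of_xy _ 0, 0)", unfolded deg2_op_parts[OF \<phi>] tpart_of_t fst_conv xpart_of_xy linear_parts mult_1_right]
    have "R_linear_map p s = 0" for s .
    then show ?thesis using R_linear_map_eq_0 by simp
  qed
  then have "inj ?f"
    unfolding linear_injective_0[OF f] by auto
  moreover have "range ?f \<subseteq> tanaka H_M 2"
    using jet2_in_tanaka[OF R_linear_R_linear_map] by auto
  ultimately show ?thesis
    using dim_inj_image_le[OF H_M.findim_tanaka f, of 2] by simp
qed

lemma dim_tanaka_neg: "dim (tanaka H_M (-1)) = 14" "dim (tanaka H_M (-2)) = 8"
proof -
  have inj: "inj (adjoint_jet B)"
    unfolding linear_injective_0[OF H_M.linear_adjoint_jet] by (metis adjoint_jet_Nil zero_fun_apply)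
  have d: "dim (tanaka H_M p) = dim (m_deg p :: (7, 8) neg set)" if "p < 0" for p
    unfolding H_M.tanaka_neg[OF that]
    by (rule dim_inj_on_image[OF H_M.linear_adjoint_jet inj_on_subset[OF inj subset_UNIV]])
  have "m_deg (-1) = (\<lambda>z. (z, 0::real^8)) ` (UNIV :: (complex^7) set)" by (auto simp: m_deg_def)
  moreover have "linear (\<lambda>z :: complex^7. (z, 0::real^8))" by (auto simp: linear_iff)
  ultimately have "dim (m_deg (-1) :: (7, 8) neg set) = dim (UNIV :: (complex^7) set)"
    using dim_inj_on_image[of "\<lambda>z :: complex^7. (z, 0::real^8)" UNIV] by (simp add: inj_on_def)
  then show "dim (tanaka H_M (-1)) = 14" using d[of "-1"] by simp
  have "m_deg (-2) = (\<lambda>t. (0::complex^7, t)) ` (UNIV :: (real^8) set)" by (auto simp: m_deg_def)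
  moreover have "linear (\<lambda>t :: real^8. (0::complex^7, t))" by (auto simp: linear_iff)
  ultimately have "dim (m_deg (-2) :: (7, 8) neg set) = dim (UNIV :: (real^8) set)"
    using dim_inj_on_image[of "\<lambda>t :: real^8. (0::complex^7, t)" UNIV] by (simp add: inj_on_def)
  then show "dim (tanaka H_M (-2)) = 8" using d[of "-2"] by simp
qed

theorem mainTheorem4:
  fixes G :: "int \<Rightarrow> 'a::real_vector set"
    and br :: "'a \<Rightarrow> 'a \<Rightarrow> 'a"
    and \<iota> :: "(7, 8) nonpos \<Rightarrow> 'a"
  assumes "levi_tanaka_algebra H_M G br \<iota>"
  shows "dim (G 1) \<ge> 16 \<and> (16::nat) > 14 \<and> 14 = dim (G (-1)) \<and>
         dim (G 2) \<ge> 10 \<and> (10::nat) > 8 \<and> 8 = dim (G (-2))"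
  unfolding levi_tanaka_dim[OF assms] using dim_tanaka_1 dim_tanaka_2 dim_tanaka_neg by simp

end
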